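(* Let $\mathbb K$ be an algebraically closed field of characteristic zero. Let $F=y^{d-1}z+a_1x^d+a_2x^2y^{d-2}+a_3xy^{d-1}+a_4y^d\in\mathbb K[x,y,z]$, with $d\geq 5$, $a_1,a_2,a_3,a_4\in\mathbb K$ and $a_1,a_2\neq 0$. Then: (1) $V(F)$ is an irreducible free divisor for any $d\geq 5$. (2) The gradient ideal $J_F=\langle F_x,F_y,F_z\rangle$ is of linear type if and only if $d=5$.
   Context: For a squarefree $F\in R=\mathbb K[x,y,z]$, $D_F=\{\theta\in{\rm Der}_{\mathbb K}(R):\theta(F)\in\langle F\rangle\}$, and $V(F)$ is a free divisor if $D_F$ is a free $R$-module; for homogeneous squarefree $F$ with singular curve this is equivalent to $R/J_F$ being Cohen–Macaulay of codimension $2$. An ideal is of linear type if the canonical surjection from its symmetric algebra to its Rees algebra is an isomorphism. *)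

theory Defs
  imports
    "HOL-Algebra.Algebraic_Closure_Type"
    "HOL-Algebra.Generated_Rings"
    "HOL-Algebra.QuotRing"
    "HOL-Library.Function_Algebras"
    "HOL-Library.Poly_Mapping"
    "HOL-Computational_Algebra.Computational_Algebra"
begin

hide_const (open) UnivPoly.coeff UnivPoly.monom

text \<open>\<open>R = K[x,y,z]\<close> is represented as \<open>K[x][y][z]\<close>: the outermost variable is \<open>z\<close>.\<close>

type_synonym 'k poly3 = "'k poly poly poly"

definition const3 :: "'k::comm_ring_1 \<Rightarrow> 'k poly3" where
  "const3 c = [:[:[:c:]:]:]"

definition varX :: "'k::comm_ring_1 poly3" where "varX = [:[:[:0, 1:]:]:]"
definition varY :: "'k::comm_ring_1 poly3" where "varY = [:[:0, 1:]:]"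
definition varZ :: "'k::comm_ring_1 poly3" where "varZ = [:0, 1:]"

fun eval3 :: "'k::comm_ring_1 poly3 \<Rightarrow> 'k \<times> 'k \<times> 'k \<Rightarrow> 'k" where
  "eval3 p (a, b, c) = poly (poly (poly p [:[:c:]:]) [:b:]) a"

definition dX :: "'k::idom poly3 \<Rightarrow> 'k poly3" where "dX = map_poly (map_poly pderiv)"
definition dY :: "'k::idom poly3 \<Rightarrow> 'k poly3" where "dY = map_poly pderiv"
definition dZ :: "'k::idom poly3 \<Rightarrow> 'k poly3" where "dZ = pderiv"

definition gradient_ideal :: "'k::idom poly3 \<Rightarrow> 'k poly3 set" where
  "gradient_ideal F = Idl\<^bsub>ring_of_type_algebra\<^esub> {dX F, dY F, dZ F}"


text \<open>\<open>V(F)\<close> is the surface in affine 3-space, i.e. the affine cone over the plane curve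
  when \<open>F\<close> is homogeneous.\<close>

definition zero_locus :: "'k::comm_ring_1 poly3 set \<Rightarrow> ('k \<times> 'k \<times> 'k) set" where
  "zero_locus P = {u. \<forall>p\<in>P. eval3 p u = 0}"

definition zariski_closed :: "('k::comm_ring_1 \<times> 'k \<times> 'k) set \<Rightarrow> bool" where
  "zariski_closed A \<longleftrightarrow> (\<exists>P. A = zero_locus P)"

definition irreducible_algebraic_set :: "('k::comm_ring_1 \<times> 'k \<times> 'k) set \<Rightarrow> bool" where
  "irreducible_algebraic_set W \<longleftrightarrow> zariski_closed W \<and> W \<noteq> {} \<and>
     (\<forall>A B. zariski_closed A \<longrightarrow> zariski_closed B \<longrightarrow> W = A \<union> B \<longrightarrow> W = A \<or> W = B)"


definition is_derivation :: "('k::comm_ring_1 poly3 \<Rightarrow> 'k poly3) \<Rightarrow> bool" where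
  "is_derivation \<theta> \<longleftrightarrow>
     (\<forall>p q. \<theta> (p + q) = \<theta> p + \<theta> q) \<and>
     (\<forall>c p. \<theta> (const3 c * p) = const3 c * \<theta> p) \<and>
     (\<forall>p q. \<theta> (p * q) = \<theta> p * q + p * \<theta> q)"

definition log_derivations :: "'k::comm_ring_1 poly3 \<Rightarrow> ('k poly3 \<Rightarrow> 'k poly3) set" where
  "log_derivations F = {\<theta>. is_derivation \<theta> \<and> \<theta> F \<in> Idl\<^bsub>ring_of_type_algebra\<^esub> {F}}"

text \<open>Derivations are functions \<open>R \<Rightarrow> R\<close>; all such functions form an \<open>R\<close>-module
  (addition from \<^theory>\<open>HOL-Library.Function_Algebras\<close>), in which \<open>D\<^sub>F\<close> is a submodule.\<close>

definition fun_scale :: "'r::comm_ring_1 \<Rightarrow> ('r \<Rightarrow> 'r) \<Rightarrow> 'r \<Rightarrow> 'r" where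
  "fun_scale r \<theta> = (\<lambda>p. r * \<theta> p)"

global_interpretation fun_module: Modules.module fun_scale
  by unfold_locales (auto simp: fun_scale_def fun_eq_iff algebra_simps)

definition free_submodule :: "('r::comm_ring_1 \<Rightarrow> 'r) set \<Rightarrow> bool" where
  "free_submodule D \<longleftrightarrow>
     (\<exists>B\<subseteq>D. fun_module.independent B \<and> fun_module.span B = D)"

definition free_divisor :: "'k::field poly3 \<Rightarrow> bool" where
  "free_divisor F \<longleftrightarrow> squarefree F \<and> free_submodule (log_derivations F)"


text \<open>\<open>Sym\<^sub>R(M)\<close> for an \<open>R\<close>-module \<open>M\<close> is the polynomial ring over \<open>R\<close> with one
  variable \<open>sym_var m\<close> for each \<open>m \<in> M\<close>, modulo the relations that make
  \<open>m \<mapsto> sym_var m\<close> linear over \<open>R\<close>. The type \<open>('m \<Rightarrow>\<^sub>0 nat) \<Rightarrow>\<^sub>0 'r\<close> has a variable for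
  every element of \<open>'m\<close>, so the carrier is cut down to the polynomials in the variables
  from \<open>M\<close>.\<close>

definition sym_var :: "'m \<Rightarrow> ('m \<Rightarrow>\<^sub>0 nat) \<Rightarrow>\<^sub>0 'r::comm_ring_1" where
  "sym_var m = Poly_Mapping.single (Poly_Mapping.single m 1) 1"

definition sym_const :: "'r::comm_ring_1 \<Rightarrow> ('m \<Rightarrow>\<^sub>0 nat) \<Rightarrow>\<^sub>0 'r" where
  "sym_const r = Poly_Mapping.single 0 r"

definition sym_poly_ring :: "'m set \<Rightarrow> (('m \<Rightarrow>\<^sub>0 nat) \<Rightarrow>\<^sub>0 'r::comm_ring_1) ring" where
  "sym_poly_ring M = ring_of_type_algebra
     \<lparr>carrier := {p. \<forall>\<mu>\<in>Poly_Mapping.keys p. Poly_Mapping.keys \<mu> \<subseteq> M}\<rparr>"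

definition sym_relations ::
  "('r::comm_ring_1 \<Rightarrow> 'm::ab_group_add \<Rightarrow> 'm) \<Rightarrow> 'm set \<Rightarrow> (('m \<Rightarrow>\<^sub>0 nat) \<Rightarrow>\<^sub>0 'r) set" where
  "sym_relations scale M =
     {sym_var (m + n) - sym_var m - sym_var n | m n. m \<in> M \<and> n \<in> M} \<union>
     {sym_var (scale r m) - sym_const r * sym_var m | r m. m \<in> M}"

definition symmetric_algebra ::
  "('r::comm_ring_1 \<Rightarrow> 'm::ab_group_add \<Rightarrow> 'm) \<Rightarrow> 'm set \<Rightarrow> (('m \<Rightarrow>\<^sub>0 nat) \<Rightarrow>\<^sub>0 'r) set ring" where
  "symmetric_algebra scale M =
     sym_poly_ring M Quot (Idl\<^bsub>sym_poly_ring M\<^esub> (sym_relations scale M))"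

text \<open>The Rees algebra is \<open>R[I t]\<close>, the subalgebra of \<open>R[t]\<close> generated by \<open>I t\<close>.\<close>

definition rees_algebra :: "'r::comm_ring_1 set \<Rightarrow> 'r poly ring" where
  "rees_algebra I = ring_of_type_algebra
     \<lparr>carrier := generate_ring ring_of_type_algebra (range (\<lambda>r. [:r:]) \<union> {monom m 1 | m. m \<in> I})\<rparr>"

text \<open>The evaluation of polynomials in the variables \<open>sym_var m\<close> that substitutes \<open>m t\<close> for
  \<open>sym_var m\<close>; it induces the canonical map from \<open>Sym\<^sub>R(I)\<close>, whose elements are cosets.\<close>

definition rees_eval :: "(('r \<Rightarrow>\<^sub>0 nat) \<Rightarrow>\<^sub>0 'r::comm_ring_1) \<Rightarrow> 'r poly" where
  "rees_eval p = (\<Sum>\<mu>\<in>Poly_Mapping.keys p.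
     [:Poly_Mapping.lookup p \<mu>:] *
     (\<Prod>m\<in>Poly_Mapping.keys \<mu>. monom m 1 ^ Poly_Mapping.lookup \<mu> m))"

definition sym_to_rees :: "(('r \<Rightarrow>\<^sub>0 nat) \<Rightarrow>\<^sub>0 'r::comm_ring_1) set \<Rightarrow> 'r poly" where
  "sym_to_rees C = the_elem (rees_eval ` C)"

definition linear_type :: "'r::comm_ring_1 set \<Rightarrow> bool" where
  "linear_type I \<longleftrightarrow> sym_to_rees \<in> ring_iso (symmetric_algebra (*) I) (rees_algebra I)"

end

theory Submission
  imports Defs
begin

text \<open>
  With \<open>d = n + 5\<close> and the linear form \<open>w = z + a\<^sub>3 x + a\<^sub>4 y\<close> the polynomial becomes
  \<open>F = y\<^bsup>d-1\<^esup> w + a\<^sub>1 x\<^bsup>d\<^esup> + a\<^sub>2 x\<^sup>2 y\<^bsup>d-2\<^esup>\<close>, and its partial derivatives with respect to the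
  coordinates \<open>x, y, w\<close> generate the same ideal as \<open>F\<^sub>x, F\<^sub>y, F\<^sub>z\<close>. They are
  \<open>f\<^sub>1 = d a\<^sub>1 x\<^bsup>d-1\<^esup> + 2 a\<^sub>2 x y\<^bsup>d-2\<^esup>\<close>, \<open>f\<^sub>2 = y\<^bsup>d-3\<^esup> Q\<close> and \<open>f\<^sub>3 = y\<^bsup>d-1\<^esup>\<close> with
  \<open>Q = (d-1) y w + (d-2) a\<^sub>2 x\<^sup>2\<close>.

  Everything rests on the syzygies of \<open>(f\<^sub>1, f\<^sub>2, f\<^sub>3)\<close>. The last two entries share the factor
  \<open>y\<^bsup>d-3\<^esup>\<close>, which gives the syzygy \<open>(0, y\<^sup>2, -Q)\<close>. Modulo \<open>(Q, y\<^sup>2)\<close> the square of \<open>x\<^sup>2\<close> is a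
  multiple of \<open>(y w)\<^sup>2 = 0\<close>, so \<open>x\<^sup>4\<close>, and with it \<open>f\<^sub>1\<close>, lies in \<open>(Q, y\<^sup>2)\<close> because
  \<open>d - 1 \<ge> 4\<close>; this gives a syzygy \<open>(y\<^bsup>d-3\<^esup>, -p\<^sub>2, -q\<^sub>2)\<close>. As \<open>y\<close> is prime and divides neither
  \<open>f\<^sub>1\<close> nor \<open>Q\<close>, these two generate all syzygies (\<open>syzygies_generated\<close>).

  A derivation \<open>\<theta>\<close> with \<open>\<theta> F = r F\<close> differs from \<open>r/d\<close> times the Euler field by a derivation that
  annihilates \<open>F\<close>, that is, by a syzygy. So the Euler field and the two syzygies form a basis of the
  logarithmic derivations. The polynomial \<open>F\<close> is squarefree since it has degree one in \<open>z\<close> with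
  coprime coefficients, and its zero locus is irreducible since it is the image of the affine plane
  under a polynomial map (\<open>zero_locus_F_parametrized\<close>).

  The symmetric algebra of the gradient ideal is \<open>R[T\<^sub>1, T\<^sub>2, T\<^sub>3] / (L\<^sub>1, L\<^sub>2)\<close>, where
  \<open>L\<^sub>1 = y\<^sup>2 T\<^sub>2 - Q T\<^sub>3\<close> and \<open>L\<^sub>2 = y\<^bsup>d-3\<^esup> T\<^sub>1 - p\<^sub>2 T\<^sub>2 - q\<^sub>2 T\<^sub>3\<close>, so linear type says that
  \<open>(L\<^sub>1, L\<^sub>2)\<close> is the kernel of \<open>T\<^sub>i \<mapsto> f\<^sub>i t\<close> (\<open>linear_type_iff_presentation\<close>). Once
  \<open>y\<close> is inverted both sides agree, so the question is whether \<open>y\<close> is a non-zero-divisor modulo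
  \<open>(L\<^sub>1, L\<^sub>2)\<close>. Modulo \<open>y\<close> the two forms are constant multiples of \<open>x\<^sup>2 T\<^sub>3\<close> and
  of \<open>x\<^bsup>d-5\<^esup>\<close> times a form prime to \<open>x\<close> and \<open>T\<^sub>3\<close>. For \<open>d = 5\<close> they are coprime
  and \<open>y\<close> can be cancelled. For \<open>d > 5\<close> both lie in the ideal \<open>(x, y)\<close>, and the determinant of their
  coefficients with respect to \<open>y\<close> and \<open>x\<close> (a Jacobian dual) is an element of the kernel outside
  \<open>(L\<^sub>1, L\<^sub>2)\<close>.
\<close>

section \<open>Homomorphisms of commutative rings\<close>

locale comm_hom =
  fixes h :: "'a::comm_ring_1 \<Rightarrow> 'b::comm_ring_1"
  assumes add [simp]: "h (x + y) = h x + h y"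
    and mult [simp]: "h (x * y) = h x * h y"
    and one [simp]: "h 1 = 1"
begin

lemma zero [simp]: "h 0 = 0"
  using add[of 0 0] by simp

lemma uminus [simp]: "h (- x) = - h x"
  using add[of x "- x"] by (simp add: eq_neg_iff_add_eq_0 add.commute)

lemma diff [simp]: "h (x - y) = h x - h y"
  using add[of x "- y"] by simp

lemma power [simp]: "h (x ^ n) = h x ^ n"
  by (induction n) simp_all

lemma of_nat [simp]: "h (of_nat n) = of_nat n"
  by (induction n) simp_all

lemma numeral [simp]: "h (numeral n) = numeral n"
  using of_nat[of "numeral n"] by simp

lemma hom_sum: "h (sum f A) = (\<Sum>x\<in>A. h (f x))"
  by (induction A rule: infinite_finite_induct) simp_all

end

lemma comm_hom_compose: "comm_hom g \<Longrightarrow> comm_hom h \<Longrightarrow> comm_hom (\<lambda>x. g (h x))"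
  unfolding comm_hom_def by simp

lemma comm_hom_const: "comm_hom (\<lambda>c. [:c:])"
  by unfold_locales (simp_all add: one_pCons)

lemma comm_hom_poly: "comm_hom (\<lambda>p. poly p a)"
  by unfold_locales simp_all

lemma comm_hom_coeff_0: "comm_hom (\<lambda>p. coeff p 0)"
  by unfold_locales (simp_all add: coeff_mult)

lemma comm_hom_map_poly:
  assumes "comm_hom h"
  shows "comm_hom (map_poly h)"
proof -
  interpret comm_hom h by fact
  show ?thesis
    by unfold_locales
      (simp_all add: poly_eq_iff coeff_map_poly coeff_mult hom_sum)
qed

definition subst_poly :: "('a::comm_ring_1 \<Rightarrow> 'b::comm_ring_1) \<Rightarrow> 'b \<Rightarrow> 'a poly \<Rightarrow> 'b" where
  "subst_poly h b p = poly (map_poly h p) b"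

lemma comm_hom_subst_poly: "comm_hom h \<Longrightarrow> comm_hom (subst_poly h b)"
  unfolding subst_poly_def
  by (intro comm_hom_compose[OF comm_hom_poly] comm_hom_map_poly)

lemma subst_poly_pCons:
  assumes "comm_hom h"
  shows "subst_poly h b (pCons c p) = h c + b * subst_poly h b p"
proof -
  interpret comm_hom h by fact
  show ?thesis by (simp add: subst_poly_def map_poly_pCons)
qed

lemma subst_poly_0 [simp]: "subst_poly h b 0 = 0"
  by (simp add: subst_poly_def)

subsection \<open>Kernels generated by two elements\<close>

text \<open>Later \<open>h\<close> is reduction modulo a prime ideal \<open>(y)\<close>, \<open>(x, y)\<close> or
  \<open>(y, T\<^sub>3)\<close>; since its codomain is then an integral domain, primality of the ideal needs no
  separate argument. A principal kernel has second generator \<open>0\<close>.\<close>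

definition kernel_generated_by ::
  "('a::comm_ring_1 \<Rightarrow> 'b::comm_ring_1) \<Rightarrow> 'a \<Rightarrow> 'a \<Rightarrow> bool" where
  "kernel_generated_by h x y \<longleftrightarrow>
     comm_hom h \<and> h x = 0 \<and> h y = 0 \<and> (\<forall>c. h c = 0 \<longrightarrow> (\<exists>a b. c = x * a + y * b))"

lemma kernel_generated_by_map_poly:
  assumes "kernel_generated_by h x y"
  shows "kernel_generated_by (map_poly h) [:x:] [:y:]"
proof -
  interpret comm_hom h using assms by (simp add: kernel_generated_by_def)
  have "\<exists>a b. p = [:x:] * a + [:y:] * b" if "map_poly h p = 0" for p
    using that
  proof (induction p)
    case 0
    show ?case by (intro exI[of _ 0]) simp
  next
    case (pCons c p)
    from pCons.prems have "h c = 0" "map_poly h p = 0"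
      by (auto simp: map_poly_pCons)
    then obtain a b p1 p2 where "c = x * a + y * b" "p = [:x:] * p1 + [:y:] * p2"
      using assms pCons.IH by (auto simp: kernel_generated_by_def)
    then have "pCons c p = [:x:] * pCons a p1 + [:y:] * pCons b p2"
      by simp
    then show ?case by blast
  qed
  then show ?thesis
    using assms by (auto simp: kernel_generated_by_def comm_hom_map_poly map_poly_pCons)
qed

section \<open>Evaluation of polynomials in arbitrarily many variables\<close>

text \<open>The homomorphism on the coefficients is a parameter, so that both \<^const>\<open>rees_eval\<close> and the
  map onto a presentation of the symmetric algebra are instances.\<close>

definition eval_monomial :: "('m \<Rightarrow> 's::comm_ring_1) \<Rightarrow> ('m \<Rightarrow>\<^sub>0 nat) \<Rightarrow> 's" where
  "eval_monomial v \<mu> = (\<Prod>m\<in>Poly_Mapping.keys \<mu>. v m ^ Poly_Mapping.lookup \<mu> m)"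

definition eval_pm ::
  "('r::comm_ring_1 \<Rightarrow> 's::comm_ring_1) \<Rightarrow> ('m \<Rightarrow> 's) \<Rightarrow> (('m \<Rightarrow>\<^sub>0 nat) \<Rightarrow>\<^sub>0 'r) \<Rightarrow> 's" where
  "eval_pm h v p = (\<Sum>\<mu>\<in>Poly_Mapping.keys p. h (Poly_Mapping.lookup p \<mu>) * eval_monomial v \<mu>)"

lemma eval_monomial_superset:
  assumes "finite A" "Poly_Mapping.keys \<mu> \<subseteq> A"
  shows "eval_monomial v \<mu> = (\<Prod>m\<in>A. v m ^ Poly_Mapping.lookup \<mu> m)"
  unfolding eval_monomial_def
  by (intro prod.mono_neutral_left) (use assms in \<open>auto simp: in_keys_iff\<close>)

lemma eval_monomial_add: "eval_monomial v (\<mu> + \<nu>) = eval_monomial v \<mu> * eval_monomial v \<nu>"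
proof -
  define A where "A = Poly_Mapping.keys \<mu> \<union> Poly_Mapping.keys \<nu>"
  have "finite A" "Poly_Mapping.keys \<mu> \<subseteq> A" "Poly_Mapping.keys \<nu> \<subseteq> A"
    "Poly_Mapping.keys (\<mu> + \<nu>) \<subseteq> A"
    using Poly_Mapping.keys_add[of \<mu> \<nu>] by (auto simp: A_def)
  then show ?thesis
    by (simp add: eval_monomial_superset lookup_add power_add prod.distrib)
qed

lemma eval_monomial_0 [simp]: "eval_monomial v 0 = 1"
  by (simp add: eval_monomial_def)

lemma poly_mapping_single_induct [case_names zero add_single]:
  assumes "P 0" "\<And>\<mu> c p. c \<noteq> 0 \<Longrightarrow> \<mu> \<notin> Poly_Mapping.keys p \<Longrightarrow> P p \<Longrightarrow> P (Poly_Mapping.single \<mu> c + p)"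
  shows "P (p :: 'x \<Rightarrow>\<^sub>0 'y::comm_monoid_add)"
proof (induction p rule: Poly_Mapping.update_induct)
  case const
  show ?case by fact
next
  case (update f a b)
  have "Poly_Mapping.update a b f = Poly_Mapping.single a b + f"
    using update(1)
    by (intro poly_mapping_eqI)
      (auto simp: lookup_update lookup_add lookup_single in_keys_iff when_def)
  with update assms(2) show ?case by simp
qed

context
  fixes h :: "'r::comm_ring_1 \<Rightarrow> 's::comm_ring_1" and v :: "'m \<Rightarrow> 's"
  assumes h: "comm_hom h"
begin

interpretation h: comm_hom h by (rule h)

lemma eval_pm_superset:
  assumes "finite A" "Poly_Mapping.keys p \<subseteq> A"
  shows "eval_pm h v p = (\<Sum>\<mu>\<in>A. h (Poly_Mapping.lookup p \<mu>) * eval_monomial v \<mu>)"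
  unfolding eval_pm_def
  by (intro sum.mono_neutral_left) (use assms in \<open>auto simp: in_keys_iff\<close>)

lemma eval_pm_add: "eval_pm h v (p + q) = eval_pm h v p + eval_pm h v q"
proof -
  define A where "A = Poly_Mapping.keys p \<union> Poly_Mapping.keys q"
  have "finite A" "Poly_Mapping.keys p \<subseteq> A" "Poly_Mapping.keys q \<subseteq> A"
    "Poly_Mapping.keys (p + q) \<subseteq> A"
    using Poly_Mapping.keys_add[of p q] by (auto simp: A_def)
  then show ?thesis
    by (simp add: eval_pm_superset lookup_add sum.distrib distrib_right)
qed

lemma eval_pm_single: "eval_pm h v (Poly_Mapping.single \<mu> c) = h c * eval_monomial v \<mu>"
  by (simp add: eval_pm_def)

lemma eval_pm_single_mult:
  "eval_pm h v (Poly_Mapping.single \<mu> c * q) = h c * eval_monomial v \<mu> * eval_pm h v q"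
proof (induction q rule: poly_mapping_single_induct)
  case zero
  show ?case by (simp add: eval_pm_def)
next
  case (add_single \<nu> e q)
  then show ?case
    by (simp add: distrib_left eval_pm_add mult_single eval_pm_single eval_monomial_add algebra_simps)
qed

lemma comm_hom_eval_pm: "comm_hom (eval_pm h v)"
proof
  fix p q :: "('m \<Rightarrow>\<^sub>0 nat) \<Rightarrow>\<^sub>0 'r"
  show "eval_pm h v (p + q) = eval_pm h v p + eval_pm h v q"
    by (rule eval_pm_add)
  show "eval_pm h v (p * q) = eval_pm h v p * eval_pm h v q"
  proof (induction p rule: poly_mapping_single_induct)
    case zero
    show ?case by (simp add: eval_pm_def)
  next
    case (add_single \<mu> c p)
    then show ?case
      by (simp add: distrib_right eval_pm_add eval_pm_single_mult eval_pm_single)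
  qed
  show "eval_pm h v 1 = 1"
    using eval_pm_single[of 0 1] by simp
qed

lemma eval_pm_var: "eval_pm h v (sym_var m) = v m"
  by (simp add: sym_var_def eval_pm_single eval_monomial_def)

lemma eval_pm_const: "eval_pm h v (sym_const c) = h c"
  by (simp add: sym_const_def eval_pm_single)

end

section \<open>Linear type as an equality of ideals\<close>

lemma ring_of_type_algebra_simps [simp]:
  "carrier ring_of_type_algebra = UNIV"
  "x \<oplus>\<^bsub>ring_of_type_algebra\<^esub> y = x + y"
  "x \<otimes>\<^bsub>ring_of_type_algebra\<^esub> y = x * y"
  "\<zero>\<^bsub>ring_of_type_algebra\<^esub> = 0"
  "\<one>\<^bsub>ring_of_type_algebra\<^esub> = 1"
  by (simp_all add: ring_of_type_algebra_def)

lemma a_inv_ring_of_type_algebra [simp]: "\<ominus>\<^bsub>ring_of_type_algebra\<^esub> x = - (x :: 'a::comm_ring_1)"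
proof -
  interpret cring "ring_of_type_algebra :: 'a ring"
    by (rule cring_from_type_algebra)
  show ?thesis
    by (rule minus_equality) simp_all
qed

lemma ideal_of_type_algebraI:
  fixes I :: "'a::comm_ring_1 set"
  assumes "0 \<in> I" "\<And>x y. x \<in> I \<Longrightarrow> y \<in> I \<Longrightarrow> x + y \<in> I" "\<And>r x. x \<in> I \<Longrightarrow> r * x \<in> I"
  shows "ideal I ring_of_type_algebra"
proof -
  interpret cring "ring_of_type_algebra :: 'a ring"
    by (rule cring_from_type_algebra)
  have neg: "- x \<in> I" if "x \<in> I" for x
    using assms(3)[OF that, of "-1"] by simp
  show ?thesis
  proof (rule idealI)
    show "subgroup I (add_monoid ring_of_type_algebra)"
      by (rule add.subgroupI) (use assms neg in auto)
  qed (use assms in \<open>auto simp: mult.commute\<close>, unfold_locales)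
qed

lemma genideal_type_algebra_insert3:
  fixes f g h :: "'a::comm_ring_1"
  shows "Idl\<^bsub>ring_of_type_algebra\<^esub> {f, g, h} = {a * f + b * g + c * h | a b c. True}" (is "?L = ?I")
proof -
  interpret cring "ring_of_type_algebra :: 'a ring"
    by (rule cring_from_type_algebra)
  have "ideal ?I ring_of_type_algebra"
  proof (rule ideal_of_type_algebraI)
    have "0 = 0 * f + 0 * g + 0 * h" by simp
    then show "0 \<in> ?I" by blast
  next
    fix x y assume "x \<in> ?I" "y \<in> ?I"
    then obtain a b c a' b' c' where "x = a * f + b * g + c * h" "y = a' * f + b' * g + c' * h"
      by blast
    then have "x + y = (a + a') * f + (b + b') * g + (c + c') * h"
      by (simp add: algebra_simps)
    then show "x + y \<in> ?I" by blast
  next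
    fix r x assume "x \<in> ?I"
    then obtain a b c where "x = a * f + b * g + c * h"
      by blast
    then have "r * x = (r * a) * f + (r * b) * g + (r * c) * h"
      by (simp add: algebra_simps)
    then show "r * x \<in> ?I" by blast
  qed
  moreover have "f = 1 * f + 0 * g + 0 * h" "g = 0 * f + 1 * g + 0 * h" "h = 0 * f + 0 * g + 1 * h"
    by simp_all
  then have "f \<in> ?I" "g \<in> ?I" "h \<in> ?I"
    by blast+
  ultimately have "?L \<subseteq> ?I"
    by (intro genideal_minimal) auto
  moreover have "?I \<subseteq> ?L"
  proof
    fix x assume "x \<in> ?I"
    then obtain a b c where x: "x = a * f + b * g + c * h"
      by blast
    interpret I: ideal ?L "ring_of_type_algebra :: 'a ring"
      by (rule genideal_ideal) simp
    have "f \<in> ?L" "g \<in> ?L" "h \<in> ?L"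
      using genideal_self[of "{f, g, h}"] by auto
    then have "a * f \<in> ?L" "b * g \<in> ?L" "c * h \<in> ?L"
      using I.I_l_closed by simp_all
    then show "x \<in> ?L"
      unfolding x using I.a_closed by simp
  qed
  ultimately show ?thesis by blast
qed

lemma genideal_type_algebra_singleton:
  fixes f :: "'a::comm_ring_1"
  shows "Idl\<^bsub>ring_of_type_algebra\<^esub> {f} = {a * f | a. True}"
proof -
  interpret cring "ring_of_type_algebra :: 'a ring"
    by (rule cring_from_type_algebra)
  show ?thesis
    using cgenideal_eq_genideal[of f] by (simp add: cgenideal_def)
qed

text \<open>The carrier of \<^const>\<open>sym_poly_ring\<close>, stated without the record so that closure properties
  can be used as plain set membership.\<close>

definition polys_over :: "'m set \<Rightarrow> (('m \<Rightarrow>\<^sub>0 nat) \<Rightarrow>\<^sub>0 'r::comm_ring_1) set" where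
  "polys_over M = {p. \<forall>\<mu>\<in>Poly_Mapping.keys p. Poly_Mapping.keys \<mu> \<subseteq> M}"

lemma polys_over_0 [simp]: "0 \<in> polys_over M"
  and polys_over_1 [simp]: "1 \<in> polys_over M"
  by (simp_all add: polys_over_def)

lemma polys_over_add: "p \<in> polys_over M \<Longrightarrow> q \<in> polys_over M \<Longrightarrow> p + q \<in> polys_over M"
  using Poly_Mapping.keys_add[of p q] unfolding polys_over_def by blast

lemma polys_over_uminus: "p \<in> polys_over M \<Longrightarrow> - p \<in> polys_over M"
  unfolding polys_over_def by (auto simp: in_keys_iff)

lemma polys_over_diff: "p \<in> polys_over M \<Longrightarrow> q \<in> polys_over M \<Longrightarrow> p - q \<in> polys_over M"
  using polys_over_add[of p M "- q"] polys_over_uminus[of q M] by simp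

lemma polys_over_mult:
  assumes "p \<in> polys_over M" "q \<in> polys_over M"
  shows "p * q \<in> polys_over M"
  unfolding polys_over_def
proof safe
  fix \<mu> m assume \<mu>: "\<mu> \<in> Poly_Mapping.keys (p * q)" "m \<in> Poly_Mapping.keys \<mu>"
  from \<mu>(1) obtain \<alpha> \<beta> where "\<alpha> \<in> Poly_Mapping.keys p" "\<beta> \<in> Poly_Mapping.keys q" "\<mu> = \<alpha> + \<beta>"
    using Poly_Mapping.keys_mult[of p q] by blast
  with \<mu>(2) Poly_Mapping.keys_add[of \<alpha> \<beta>] assms show "m \<in> M"
    unfolding polys_over_def by blast
qed

lemma sym_var_in_polys_over: "m \<in> M \<Longrightarrow> sym_var m \<in> polys_over M"
  by (simp add: polys_over_def sym_var_def)

lemma sym_const_in_polys_over [simp]: "sym_const r \<in> polys_over M"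
  by (simp add: polys_over_def sym_const_def)

lemma sym_poly_ring_simps [simp]:
  "carrier (sym_poly_ring M) = polys_over M"
  "p \<oplus>\<^bsub>sym_poly_ring M\<^esub> q = p + q"
  "p \<otimes>\<^bsub>sym_poly_ring M\<^esub> q = p * q"
  "\<zero>\<^bsub>sym_poly_ring M\<^esub> = 0"
  "\<one>\<^bsub>sym_poly_ring M\<^esub> = 1"
  by (simp_all add: sym_poly_ring_def polys_over_def ring_of_type_algebra_def)

lemma cring_sym_poly_ring:
  fixes M :: "'m set"
  shows "cring (sym_poly_ring M :: (('m \<Rightarrow>\<^sub>0 nat) \<Rightarrow>\<^sub>0 'r::comm_ring_1) ring)" (is "cring ?P")
proof (rule cringI)
  show "abelian_group ?P"
  proof (rule abelian_groupI)
    fix p assume "p \<in> carrier ?P"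
    then show "\<exists>q\<in>carrier ?P. q \<oplus>\<^bsub>?P\<^esub> p = \<zero>\<^bsub>?P\<^esub>"
      by (intro bexI[of _ "- p"]) (simp_all add: polys_over_uminus)
  qed (simp_all add: polys_over_add add_ac)
  show "Group.comm_monoid ?P"
    by (rule comm_monoidI) (simp_all add: polys_over_mult mult_ac)
qed (simp add: distrib_right)

locale subideal =
  fixes J :: "'r::comm_ring_1 set"
  assumes zero_in [simp]: "0 \<in> J"
    and add_in: "m \<in> J \<Longrightarrow> n \<in> J \<Longrightarrow> m + n \<in> J"
    and mult_in: "m \<in> J \<Longrightarrow> r * m \<in> J"
begin

abbreviation "P \<equiv> sym_poly_ring J :: (('r \<Rightarrow>\<^sub>0 nat) \<Rightarrow>\<^sub>0 'r) ring"

definition Rel :: "(('r \<Rightarrow>\<^sub>0 nat) \<Rightarrow>\<^sub>0 'r) set" where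
  "Rel = Idl\<^bsub>P\<^esub> (sym_relations (*) J)"

sublocale P: cring P
  by (rule cring_sym_poly_ring)

lemma relations_in_polys_over: "sym_relations (*) J \<subseteq> polys_over J"
  unfolding sym_relations_def
  by (auto intro!: polys_over_diff polys_over_mult sym_var_in_polys_over intro: add_in mult_in)

sublocale Rel: ideal Rel P
  unfolding Rel_def by (rule P.genideal_ideal) (simp add: relations_in_polys_over)

lemma Rel_subset: "p \<in> Rel \<Longrightarrow> p \<in> polys_over J"
  using Rel.Icarr by simp

lemma Rel_0 [simp]: "0 \<in> Rel"
  using Rel.additive_subgroup_axioms additive_subgroup.zero_closed by fastforce

lemma Rel_add: "p \<in> Rel \<Longrightarrow> q \<in> Rel \<Longrightarrow> p + q \<in> Rel"
  using Rel.a_closed by simp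

lemma Rel_mult: "p \<in> polys_over J \<Longrightarrow> q \<in> Rel \<Longrightarrow> p * q \<in> Rel"
  using Rel.I_l_closed by simp

lemma Rel_uminus: "p \<in> Rel \<Longrightarrow> - p \<in> Rel"
  using Rel_mult[of "- 1" p] by (simp add: polys_over_uminus)

lemma Rel_diff: "p \<in> Rel \<Longrightarrow> q \<in> Rel \<Longrightarrow> p - q \<in> Rel"
  using Rel_add[of p "- q"] by (simp add: Rel_uminus)

lemma Rel_var_add: "m \<in> J \<Longrightarrow> n \<in> J \<Longrightarrow> sym_var (m + n) - sym_var m - sym_var n \<in> Rel"
  unfolding Rel_def
  by (rule subsetD[OF P.genideal_self]) (use relations_in_polys_over in \<open>auto simp: sym_relations_def\<close>)

lemma Rel_var_mult: "m \<in> J \<Longrightarrow> sym_var (r * m) - sym_const r * sym_var m \<in> Rel"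
  unfolding Rel_def
  by (rule subsetD[OF P.genideal_self]) (use relations_in_polys_over in \<open>auto simp: sym_relations_def\<close>)

text \<open>The universal property of the symmetric algebra: the preimage of an ideal \<open>N\<close> is an ideal,
  and linearity of the variables modulo \<open>N\<close> puts the defining relations into it. Working modulo
  \<open>N\<close> avoids quotient rings on the target side.\<close>

lemma Rel_mapped_into_ideal:
  fixes \<phi> :: "(('r \<Rightarrow>\<^sub>0 nat) \<Rightarrow>\<^sub>0 'r) \<Rightarrow> 's::comm_ring_1"
  assumes "comm_hom \<phi>"
    and N: "0 \<in> N" "\<And>x y. x \<in> N \<Longrightarrow> y \<in> N \<Longrightarrow> x + y \<in> N" "\<And>r x. x \<in> N \<Longrightarrow> r * x \<in> N"
    and lin_add: "\<And>m n. m \<in> J \<Longrightarrow> n \<in> J \<Longrightarrow> \<phi> (sym_var (m + n)) - \<phi> (sym_var m) - \<phi> (sym_var n) \<in> N"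
    and lin_mult: "\<And>r m. m \<in> J \<Longrightarrow> \<phi> (sym_var (r * m)) - \<phi> (sym_const r) * \<phi> (sym_var m) \<in> N"
    and "p \<in> Rel"
  shows "\<phi> p \<in> N"
proof -
  interpret comm_hom \<phi> by fact
  let ?I = "{p \<in> polys_over J. \<phi> p \<in> N}"
  have neg: "- x \<in> N" if "x \<in> N" for x
    using N(3)[OF that, of "- 1"] by simp
  have "ideal ?I P"
  proof (rule idealI)
    show "ring P" by (rule P.ring_axioms)
    show "subgroup ?I (add_monoid P)"
    proof (rule P.add.subgroupI)
      fix p assume "p \<in> ?I"
      moreover from this have "\<ominus>\<^bsub>P\<^esub> p = - p"
        by (intro P.minus_equality) (auto simp: polys_over_uminus)
      ultimately show "\<ominus>\<^bsub>P\<^esub> p \<in> ?I"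
        by (simp add: polys_over_uminus neg)
    next
      have "0 \<in> ?I" using N(1) by simp
      then show "?I \<noteq> {}" by blast
    next
      fix p q assume "p \<in> ?I" "q \<in> ?I"
      then show "p \<oplus>\<^bsub>P\<^esub> q \<in> ?I"
        by (simp add: polys_over_add N(2))
    qed auto
  next
    fix p q assume "p \<in> ?I" "q \<in> carrier P"
    then show "q \<otimes>\<^bsub>P\<^esub> p \<in> ?I" "p \<otimes>\<^bsub>P\<^esub> q \<in> ?I"
      using N(3)[of "\<phi> p" "\<phi> q"] by (simp_all add: polys_over_mult mult.commute[of p])
  qed
  moreover have "sym_relations (*) J \<subseteq> ?I"
  proof
    fix q assume q: "q \<in> sym_relations (*) J"
    then consider m n where "m \<in> J" "n \<in> J" "q = sym_var (m + n) - sym_var m - sym_var n"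
      | r m where "m \<in> J" "q = sym_var (r * m) - sym_const r * sym_var m"
      unfolding sym_relations_def by blast
    then have "\<phi> q \<in> N"
      by cases (simp_all add: lin_add lin_mult)
    with q relations_in_polys_over show "q \<in> ?I" by blast
  qed
  ultimately have "Rel \<subseteq> ?I"
    unfolding Rel_def by (rule P.genideal_minimal)
  with \<open>p \<in> Rel\<close> show ?thesis by blast
qed

lemma rees_eval_eq: "rees_eval = eval_pm (\<lambda>r::'r. [:r:]) (\<lambda>m. monom m 1)"
  by (simp add: fun_eq_iff rees_eval_def eval_pm_def eval_monomial_def)

lemma comm_hom_rees_eval: "comm_hom (rees_eval :: (('r \<Rightarrow>\<^sub>0 nat) \<Rightarrow>\<^sub>0 'r) \<Rightarrow> 'r poly)"
  unfolding rees_eval_eq by (rule comm_hom_eval_pm[OF comm_hom_const])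

lemma rees_eval_var [simp]: "rees_eval (sym_var m) = monom (m :: 'r) 1"
  and rees_eval_const [simp]: "rees_eval (sym_const (r :: 'r)) = [:r:]"
  by (simp_all add: rees_eval_eq eval_pm_var comm_hom_const eval_pm_const)

lemma Rel_subset_kernel: "p \<in> Rel \<Longrightarrow> rees_eval p = 0"
  using Rel_mapped_into_ideal[OF comm_hom_rees_eval, of "{0}" p]
  by (simp add: add_monom[symmetric] smult_monom)

abbreviation "Rees_gens \<equiv> range (\<lambda>r. [:r:]) \<union> {monom m 1 | m. m \<in> J}"

lemma rees_eval_in_rees_algebra:
  assumes "p \<in> polys_over J"
  shows "rees_eval p \<in> generate_ring ring_of_type_algebra Rees_gens"
proof -
  let ?G = "generate_ring ring_of_type_algebra Rees_gens"
  note gen = generate_ring.intros[where R = "ring_of_type_algebra :: 'r poly ring", simplified]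
  have const: "[:r:] \<in> ?G" for r
    by (intro gen(2)) auto
  from const[of 0] have zero: "0 \<in> ?G" by simp
  have var: "monom m 1 \<in> ?G" if "m \<in> J" for m
    using that by (intro gen(2)) auto
  have power: "x ^ n \<in> ?G" if "x \<in> ?G" for x n
    using that by (induction n) (auto intro: gen)
  have prod: "(\<Prod>m\<in>A. f m) \<in> ?G" if "\<And>m. m \<in> A \<Longrightarrow> f m \<in> ?G" for A f
    using that by (induction A rule: infinite_finite_induct) (auto intro: gen)
  have sum: "(\<Sum>m\<in>A. f m) \<in> ?G" if "\<And>m. m \<in> A \<Longrightarrow> f m \<in> ?G" for A and f :: "('r \<Rightarrow>\<^sub>0 nat) \<Rightarrow> 'r poly"
    using that by (induction A rule: infinite_finite_induct) (auto intro: gen zero)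
  show ?thesis
    unfolding rees_eval_def
    using assms by (intro sum gen(5) const prod power var) (auto simp: polys_over_def)
qed

lemma rees_eval_onto:
  "rees_eval ` polys_over J = generate_ring ring_of_type_algebra Rees_gens"
proof
  show "rees_eval ` polys_over J \<subseteq> generate_ring ring_of_type_algebra Rees_gens"
    using rees_eval_in_rees_algebra by blast
  interpret ev: comm_hom "rees_eval :: (('r \<Rightarrow>\<^sub>0 nat) \<Rightarrow>\<^sub>0 'r) \<Rightarrow> 'r poly"
    by (rule comm_hom_rees_eval)
  show "generate_ring ring_of_type_algebra Rees_gens \<subseteq> rees_eval ` polys_over J"
  proof
    fix x assume "x \<in> generate_ring (ring_of_type_algebra :: 'r poly ring) Rees_gens"
    then show "x \<in> rees_eval ` polys_over J"
    proof induction
      case one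
      show ?case by (intro image_eqI[of _ _ 1]) simp_all
    next
      case (incl h)
      then consider r where "h = [:r:]" | m where "m \<in> J" "h = monom m 1" by blast
      then show ?case
      proof cases
        case 1
        then show ?thesis
          by (intro image_eqI[of _ _ "sym_const r"]) simp_all
      next
        case 2
        then show ?thesis
          by (intro image_eqI[of _ _ "sym_var m"]) (simp_all add: sym_var_in_polys_over)
      qed
    next
      case (a_inv h)
      then obtain p where "p \<in> polys_over J" "h = rees_eval p" by blast
      then show ?case
        by (intro image_eqI[of _ _ "- p"]) (simp_all add: polys_over_uminus)
    next
      case (eng_add h1 h2)
      then obtain p q where "p \<in> polys_over J" "h1 = rees_eval p" "q \<in> polys_over J" "h2 = rees_eval q"
        by blast
      then show ?case
        by (intro image_eqI[of _ _ "p + q"]) (simp_all add: polys_over_add)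
    next
      case (eng_mult h1 h2)
      then obtain p q where "p \<in> polys_over J" "h1 = rees_eval p" "q \<in> polys_over J" "h2 = rees_eval q"
        by blast
      then show ?case
        by (intro image_eqI[of _ _ "p * q"]) (simp_all add: polys_over_mult)
    qed
  qed
qed

lemma rees_algebra_simps [simp]:
  "carrier (rees_algebra J) = generate_ring ring_of_type_algebra Rees_gens"
  "x \<oplus>\<^bsub>rees_algebra J\<^esub> y = x + y"
  "x \<otimes>\<^bsub>rees_algebra J\<^esub> y = x * y"
  "\<zero>\<^bsub>rees_algebra J\<^esub> = 0"
  "\<one>\<^bsub>rees_algebra J\<^esub> = 1"
  by (simp_all add: rees_algebra_def ring_of_type_algebra_def)

lemma ring_hom_ring_rees_eval: "ring_hom_ring P (rees_algebra J) rees_eval"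
proof -
  interpret T: cring "ring_of_type_algebra :: 'r poly ring"
    by (rule cring_from_type_algebra)
  interpret ev: comm_hom "rees_eval :: (('r \<Rightarrow>\<^sub>0 nat) \<Rightarrow>\<^sub>0 'r) \<Rightarrow> 'r poly"
    by (rule comm_hom_rees_eval)
  show ?thesis
  proof (rule ring_hom_ringI)
    show "ring P" by (rule P.ring_axioms)
    show "ring (rees_algebra J)"
      unfolding rees_algebra_def by (rule T.generate_ring_is_ring) simp
  qed (use rees_eval_in_rees_algebra in simp_all)
qed

text \<open>The Rees algebra is the image of \<^const>\<open>rees_eval\<close>, so the canonical map is always onto and
  the isomorphism theorem identifies the Rees algebra with the quotient by the full kernel. The
  kernel always contains \<open>Rel\<close>; injectivity on cosets is the other inclusion.\<close>

theorem linear_type_iff_kernel: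
  "linear_type J \<longleftrightarrow> (\<forall>p\<in>polys_over J. rees_eval p = 0 \<longrightarrow> p \<in> Rel)"
proof
  interpret h: ring_hom_ring P "rees_algebra J" rees_eval
    by (rule ring_hom_ring_rees_eval)
  have sym_to_rees: "sym_to_rees = (\<lambda>C :: (('r \<Rightarrow>\<^sub>0 nat) \<Rightarrow>\<^sub>0 'r) set. the_elem (rees_eval ` C))"
    by (simp add: fun_eq_iff sym_to_rees_def)
  {
    assume "\<forall>p\<in>polys_over J. rees_eval p = 0 \<longrightarrow> p \<in> Rel"
    then have "a_kernel P (rees_algebra J) rees_eval = Rel"
      unfolding a_kernel_def' using Rel_subset Rel_subset_kernel
      by (intro equalityI subsetI) simp_all
    moreover have "sym_to_rees \<in> ring_iso (P Quot a_kernel P (rees_algebra J) rees_eval) (rees_algebra J)"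
      unfolding sym_to_rees by (rule h.FactRing_iso_set) (simp add: rees_eval_onto)
    ultimately show "linear_type J"
      by (simp add: linear_type_def symmetric_algebra_def Rel_def)
  next
    assume "linear_type J"
    then have "sym_to_rees \<in> ring_iso (P Quot Rel) (rees_algebra J)"
      by (simp add: linear_type_def symmetric_algebra_def Rel_def)
    then have inj: "inj_on sym_to_rees (carrier (P Quot Rel))"
      by (simp add: ring_iso_def bij_betw_def)
    show "\<forall>p\<in>polys_over J. rees_eval p = 0 \<longrightarrow> p \<in> Rel"
    proof (intro ballI impI)
      fix p assume p: "p \<in> polys_over J" "rees_eval p = 0"
      interpret ev: comm_hom "rees_eval :: (('r \<Rightarrow>\<^sub>0 nat) \<Rightarrow>\<^sub>0 'r) \<Rightarrow> 'r poly"
        by (rule comm_hom_rees_eval)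
      have "sym_to_rees (Rel +>\<^bsub>P\<^esub> q) = 0" if "rees_eval q = 0" for q
      proof -
        have "rees_eval r = 0" if r: "r \<in> Rel +>\<^bsub>P\<^esub> q" for r
        proof -
          from r obtain s where "s \<in> Rel" "r = s + q"
            unfolding a_r_coset_def' by auto
          then show ?thesis
            using \<open>rees_eval q = 0\<close> by (simp add: Rel_subset_kernel)
        qed
        moreover have "q \<in> Rel +>\<^bsub>P\<^esub> q"
          unfolding a_r_coset_def' using Rel_0 by (auto intro: bexI[of _ 0])
        ultimately have "rees_eval ` (Rel +>\<^bsub>P\<^esub> q) = {0}"
          using that by force
        then show ?thesis by (simp add: sym_to_rees_def)
      qed
      then have "sym_to_rees (Rel +>\<^bsub>P\<^esub> p) = sym_to_rees (Rel +>\<^bsub>P\<^esub> \<zero>\<^bsub>P\<^esub>)"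
        using p by simp
      moreover have "Rel +>\<^bsub>P\<^esub> q \<in> carrier (P Quot Rel)" if "q \<in> carrier P" for q
        using that P.a_rcosetsI[OF Rel.a_subset] by (simp add: FactRing_def)
      ultimately have "Rel +>\<^bsub>P\<^esub> p = Rel +>\<^bsub>P\<^esub> \<zero>\<^bsub>P\<^esub>"
        using p P.zero_closed by (intro inj_onD[OF inj]) simp_all
      also have "\<dots> = Rel"
        by (rule P.a_coset_add_zero[OF Rel.a_subset])
      finally show "p \<in> Rel"
        using Rel.a_rcos_self[of p] p(1) by (simp add: sym_poly_ring_simps(1))
    qed
  }
qed

end

section \<open>The presentation by three generators and two syzygies\<close>

lemma poly3_induct [case_names const add varX varY varZ]:
  fixes g :: "'r::comm_ring_1 poly3"
  assumes const: "\<And>c. Q (const3 c)"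
    and add: "\<And>p q. Q p \<Longrightarrow> Q q \<Longrightarrow> Q (p + q)"
    and X: "\<And>p. Q p \<Longrightarrow> Q (varX * p)"
    and Y: "\<And>p. Q p \<Longrightarrow> Q (varY * p)"
    and Z: "\<And>p. Q p \<Longrightarrow> Q (varZ * p)"
  shows "Q g"
proof -
  have zero: "Q 0"
    using const[of 0] by (simp add: const3_def)
  have 1: "Q [:[:p:]:]" for p :: "'r poly"
  proof (induction p)
    case 0
    show ?case using zero by simp
  next
    case (pCons c p)
    have "[:[:pCons c p:]:] = const3 c + varX * [:[:p:]:]"
      by (simp add: const3_def varX_def)
    then show ?case
      using add[OF const X[OF pCons.IH]] by simp
  qed
  have 2: "Q [:p:]" for p :: "'r poly poly"
  proof (induction p)
    case 0
    show ?case using zero by simp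
  next
    case (pCons c p)
    have "[:pCons c p:] = [:[:c:]:] + varY * [:p:]"
      by (simp add: varY_def)
    then show ?case
      using add[OF 1 Y[OF pCons.IH]] by simp
  qed
  show ?thesis
  proof (induction g)
    case 0
    show ?case using zero by simp
  next
    case (pCons c p)
    have "pCons c p = [:c:] + varZ * p"
      by (simp add: varZ_def)
    then show ?case
      using add[OF 2 Z[OF pCons.IH]] by simp
  qed
qed

lemma comm_hom_const3: "comm_hom const3"
  by unfold_locales (simp_all add: const3_def one_pCons)

definition subst3 :: "('a::comm_ring_1 \<Rightarrow> 'b::comm_ring_1) \<Rightarrow> 'b \<Rightarrow> 'b \<Rightarrow> 'b \<Rightarrow> 'a poly3 \<Rightarrow> 'b" where
  "subst3 h x y z = subst_poly (subst_poly (subst_poly h x) y) z"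

lemma comm_hom_subst3: "comm_hom h \<Longrightarrow> comm_hom (subst3 h x y z)"
  by (simp add: subst3_def comm_hom_subst_poly)

lemma subst3_simps:
  assumes h: "comm_hom h"
  shows "subst3 h x y z (const3 c) = h c" "subst3 h x y z varX = x"
    "subst3 h x y z varY = y" "subst3 h x y z varZ = z"
proof -
  interpret comm_hom h by fact
  show "subst3 h x y z (const3 c) = h c" "subst3 h x y z varX = x"
    "subst3 h x y z varY = y" "subst3 h x y z varZ = z"
    using h by (simp_all add: subst3_def const3_def varX_def varY_def varZ_def
        subst_poly_pCons comm_hom_subst_poly one_pCons)
qed

lemma comm_hom_poly3_unique:
  assumes g: "comm_hom g" and h: "comm_hom h"
    and eq: "\<And>c. g (const3 c) = h (const3 c)" "g varX = h varX" "g varY = h varY" "g varZ = h varZ"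
  shows "g p = h p"
  by (induction p rule: poly3_induct)
    (use eq in \<open>simp_all add: comm_hom.add[OF g] comm_hom.add[OF h] comm_hom.mult[OF g] comm_hom.mult[OF h]\<close>)

text \<open>Homomorphisms from a ring of polynomials in arbitrarily many variables can be compared
  with this rule even when they agree only modulo an ideal.\<close>

lemma polys_over_induct [consumes 1, case_names const add var]:
  fixes p :: "('m \<Rightarrow>\<^sub>0 nat) \<Rightarrow>\<^sub>0 'r::comm_ring_1"
  assumes "p \<in> polys_over M"
    and const: "\<And>c. Q (sym_const c)"
    and add: "\<And>p q. p \<in> polys_over M \<Longrightarrow> q \<in> polys_over M \<Longrightarrow> Q p \<Longrightarrow> Q q \<Longrightarrow> Q (p + q)"
    and var: "\<And>p m. p \<in> polys_over M \<Longrightarrow> m \<in> M \<Longrightarrow> Q p \<Longrightarrow> Q (p * sym_var m)"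
  shows "Q p"
proof -
  let ?s = "\<lambda>\<mu> c :: 'r. Poly_Mapping.single \<mu> c :: ('m \<Rightarrow>\<^sub>0 nat) \<Rightarrow>\<^sub>0 'r"
  have over: "?s \<mu> c \<in> polys_over M" if "Poly_Mapping.keys \<mu> \<subseteq> M" for \<mu> c
    using that by (auto simp: polys_over_def split: if_splits)
  have single: "Q (?s \<mu> c)" if "Poly_Mapping.keys \<mu> \<subseteq> M" for \<mu> c
    using that
  proof (induction \<mu> rule: poly_mapping_single_induct)
    case zero
    show ?case using const[of c] by (simp add: sym_const_def)
  next
    case (add_single m n \<mu>)
    then have keys: "Poly_Mapping.keys (Poly_Mapping.single m n + \<mu>) = insert m (Poly_Mapping.keys \<mu>)"
      by (auto simp: in_keys_iff lookup_add lookup_single when_def split: if_splits)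
    with add_single.prems have m: "m \<in> M" and \<mu>: "Poly_Mapping.keys \<mu> \<subseteq> M" by auto
    have "Q (?s (Poly_Mapping.single m k + \<mu>) c)" for k
    proof (induction k)
      case 0
      show ?case using add_single.IH[OF \<mu>] by simp
    next
      case (Suc k)
      have "Poly_Mapping.keys (Poly_Mapping.single m k + \<mu>) \<subseteq> M"
        using m \<mu> by (auto simp: subset_iff in_keys_iff lookup_add lookup_single when_def split: if_splits)
      then have "Q (?s (Poly_Mapping.single m k + \<mu>) c * sym_var m)"
        using var[OF over m Suc.IH] by simp
      moreover have "Poly_Mapping.single m (Suc k) + \<mu> = Poly_Mapping.single m k + \<mu> + Poly_Mapping.single m 1"
        by (intro poly_mapping_eqI) (auto simp: lookup_add lookup_single when_def)
      ultimately show ?case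
        by (simp add: sym_var_def mult_single)
    qed
    then show ?case .
  qed
  show ?thesis
    using assms(1)
  proof (induction p rule: poly_mapping_single_induct)
    case zero
    show ?case using const[of 0] by (simp add: sym_const_def)
  next
    case (add_single \<mu> c p)
    have "Poly_Mapping.keys (?s \<mu> c + p) = insert \<mu> (Poly_Mapping.keys p)"
      using add_single.hyps
      by (auto simp: in_keys_iff lookup_add lookup_single when_def split: if_splits)
    with add_single.prems have "Poly_Mapping.keys \<mu> \<subseteq> M" "p \<in> polys_over M"
      by (auto simp: polys_over_def)
    then show ?case
      using add_single.IH by (intro add over single)
  qed
qed

text \<open>The ring \<open>R[T\<^sub>1, T\<^sub>2, T\<^sub>3]\<close> that maps onto the symmetric algebra is a nested polynomial
  ring in three variables over \<open>R\<close>, like \<open>K[x, y, z]\<close> over \<open>K\<close>. The variable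
  \<open>T\<^sub>3\<close> is innermost because \<open>R[T\<^sub>3]\<close> has to appear as a ring of coefficients when \<open>T\<^sub>1\<close> and \<open>T\<^sub>2\<close> are eliminated.\<close>

abbreviation (input) "T\<^sub>1 \<equiv> varZ"
abbreviation (input) "T\<^sub>2 \<equiv> varY"
abbreviation (input) "T\<^sub>3 \<equiv> varX"

definition linear_form :: "'r::comm_ring_1 \<Rightarrow> 'r \<Rightarrow> 'r \<Rightarrow> 'r poly3" where
  "linear_form a b c = const3 a * T\<^sub>1 + const3 b * T\<^sub>2 + const3 c * T\<^sub>3"

definition rees_map :: "'r::comm_ring_1 \<Rightarrow> 'r \<Rightarrow> 'r \<Rightarrow> 'r poly3 \<Rightarrow> 'r poly" where
  "rees_map f\<^sub>1 f\<^sub>2 f\<^sub>3 = subst3 (\<lambda>r. [:r:]) (monom f\<^sub>3 1) (monom f\<^sub>2 1) (monom f\<^sub>1 1)"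

text \<open>The two presentations of the symmetric algebra agree. In one direction, \<open>\<Lambda>\<close> writes the
  variable of an element \<open>m\<close> of the ideal as the linear form of some expression of \<open>m\<close> in the
  generators; in the other, \<open>\<iota>\<close> sends \<open>T\<^sub>i\<close> to the variable of \<open>f\<^sub>i\<close>. Both composites are the
  identity modulo the respective relations, and both maps are compatible with the evaluation in
  \<open>R[t]\<close>, so that the two kernels correspond to each other.\<close>

theorem linear_type_iff_presentation:
  fixes f\<^sub>1 f\<^sub>2 f\<^sub>3 a\<^sub>1 b\<^sub>1 c\<^sub>1 a\<^sub>2 b\<^sub>2 c\<^sub>2 :: "'r::comm_ring_1"
  assumes syz\<^sub>1: "a\<^sub>1 * f\<^sub>1 + b\<^sub>1 * f\<^sub>2 + c\<^sub>1 * f\<^sub>3 = 0"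
    and syz\<^sub>2: "a\<^sub>2 * f\<^sub>1 + b\<^sub>2 * f\<^sub>2 + c\<^sub>2 * f\<^sub>3 = 0"
    and gen: "\<And>a b c. a * f\<^sub>1 + b * f\<^sub>2 + c * f\<^sub>3 = 0 \<Longrightarrow>
      \<exists>u v. a = u * a\<^sub>1 + v * a\<^sub>2 \<and> b = u * b\<^sub>1 + v * b\<^sub>2 \<and> c = u * c\<^sub>1 + v * c\<^sub>2"
  shows "linear_type {a * f\<^sub>1 + b * f\<^sub>2 + c * f\<^sub>3 | a b c. True} \<longleftrightarrow>
    (\<forall>g. rees_map f\<^sub>1 f\<^sub>2 f\<^sub>3 g = 0 \<longrightarrow>
      (\<exists>u v. g = u * linear_form a\<^sub>1 b\<^sub>1 c\<^sub>1 + v * linear_form a\<^sub>2 b\<^sub>2 c\<^sub>2))"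
proof -
  define J where "J = {a * f\<^sub>1 + b * f\<^sub>2 + c * f\<^sub>3 | a b c. True}"
  define L\<^sub>1 where "L\<^sub>1 = linear_form a\<^sub>1 b\<^sub>1 c\<^sub>1"
  define L\<^sub>2 where "L\<^sub>2 = linear_form a\<^sub>2 b\<^sub>2 c\<^sub>2"
  define A where "A = {u * L\<^sub>1 + v * L\<^sub>2 | u v. True}"
  interpret const3: comm_hom "const3 :: 'r \<Rightarrow> 'r poly3" by (rule comm_hom_const3)

  have J_I: "m \<in> J" if "m = a * f\<^sub>1 + b * f\<^sub>2 + c * f\<^sub>3" for m a b c
    using that unfolding J_def by blast
  interpret subideal J
  proof
    show "0 \<in> J" by (rule J_I[of _ 0 0 0]) simp
  next
    fix m n assume "m \<in> J" "n \<in> J"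
    then obtain a b c a' b' c'
      where "m = a * f\<^sub>1 + b * f\<^sub>2 + c * f\<^sub>3" "n = a' * f\<^sub>1 + b' * f\<^sub>2 + c' * f\<^sub>3"
      unfolding J_def by blast
    then show "m + n \<in> J"
      by (intro J_I[of _ "a + a'" "b + b'" "c + c'"]) (simp add: algebra_simps)
  next
    fix m r assume "m \<in> J"
    then obtain a b c where "m = a * f\<^sub>1 + b * f\<^sub>2 + c * f\<^sub>3"
      unfolding J_def by blast
    then show "r * m \<in> J"
      by (intro J_I[of _ "r * a" "r * b" "r * c"]) (simp add: algebra_simps)
  qed
  have f_in: "f\<^sub>1 \<in> J" "f\<^sub>2 \<in> J" "f\<^sub>3 \<in> J"
    by (rule J_I[of _ 1 0 0] J_I[of _ 0 1 0] J_I[of _ 0 0 1], simp)+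

  have A_I: "x \<in> A" if "x = u * L\<^sub>1 + v * L\<^sub>2" for x u v
    using that unfolding A_def by blast
  have A_0: "0 \<in> A" by (rule A_I[of _ 0 0]) simp
  have A_add: "x + y \<in> A" if "x \<in> A" "y \<in> A" for x y
  proof -
    from that obtain u v u' v' where "x = u * L\<^sub>1 + v * L\<^sub>2" "y = u' * L\<^sub>1 + v' * L\<^sub>2"
      unfolding A_def by blast
    then show ?thesis
      by (intro A_I[of _ "u + u'" "v + v'"]) (simp add: algebra_simps)
  qed
  have A_mult: "r * x \<in> A" if "x \<in> A" for r x
  proof -
    from that obtain u v where "x = u * L\<^sub>1 + v * L\<^sub>2"
      unfolding A_def by blast
    then show ?thesis
      by (intro A_I[of _ "r * u" "r * v"]) (simp add: algebra_simps)
  qed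
  have A_diff: "x - y \<in> A" if "x \<in> A" "y \<in> A" for x y
    using A_add[OF that(1) A_mult[OF that(2), of "- 1"]] by simp
  have syzygy_in_A: "linear_form a b c \<in> A" if syz: "a * f\<^sub>1 + b * f\<^sub>2 + c * f\<^sub>3 = 0" for a b c
  proof -
    from gen[OF syz] obtain u v
      where "a = u * a\<^sub>1 + v * a\<^sub>2" "b = u * b\<^sub>1 + v * b\<^sub>2" "c = u * c\<^sub>1 + v * c\<^sub>2"
      by blast
    then show ?thesis
      by (intro A_I[of _ "const3 u" "const3 v"])
        (simp add: linear_form_def L\<^sub>1_def L\<^sub>2_def algebra_simps)
  qed

  \<comment> \<open>The map from the polynomial ring over the ideal to \<open>R[T\<^sub>1, T\<^sub>2, T\<^sub>3]\<close> depends on a choice of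
    coefficients, which is only unique up to syzygies.\<close>
  obtain \<alpha> \<beta> \<gamma> where coeffs: "m = \<alpha> m * f\<^sub>1 + \<beta> m * f\<^sub>2 + \<gamma> m * f\<^sub>3" if "m \<in> J" for m
  proof -
    have "\<forall>m\<in>J. \<exists>t. m = fst t * f\<^sub>1 + fst (snd t) * f\<^sub>2 + snd (snd t) * f\<^sub>3"
      unfolding J_def by auto
    from bchoice[OF this] obtain t
      where t: "\<forall>m\<in>J. m = fst (t m) * f\<^sub>1 + fst (snd (t m)) * f\<^sub>2 + snd (snd (t m)) * f\<^sub>3" ..
    then show ?thesis
      by (intro that[of "\<lambda>m. fst (t m)" "\<lambda>m. fst (snd (t m))" "\<lambda>m. snd (snd (t m))"]) blast
  qed
  define \<Lambda> where "\<Lambda> = eval_pm const3 (\<lambda>m. linear_form (\<alpha> m) (\<beta> m) (\<gamma> m))"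
  interpret \<Lambda>: comm_hom \<Lambda>
    unfolding \<Lambda>_def by (rule comm_hom_eval_pm[OF comm_hom_const3])
  have \<Lambda>_var: "\<Lambda> (sym_var m) = linear_form (\<alpha> m) (\<beta> m) (\<gamma> m)" for m
    by (simp add: \<Lambda>_def eval_pm_var comm_hom_const3)
  have \<Lambda>_const: "\<Lambda> (sym_const r) = const3 r" for r
    by (simp add: \<Lambda>_def eval_pm_const comm_hom_const3)
  have \<Lambda>_Rel: "\<Lambda> p \<in> A" if "p \<in> Rel" for p
  proof (rule Rel_mapped_into_ideal[OF \<Lambda>.comm_hom_axioms A_0 A_add A_mult _ _ that])
    fix m n assume mn: "m \<in> J" "n \<in> J"
    have "\<Lambda> (sym_var (m + n)) - \<Lambda> (sym_var m) - \<Lambda> (sym_var n) =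
      linear_form (\<alpha> (m + n) - \<alpha> m - \<alpha> n) (\<beta> (m + n) - \<beta> m - \<beta> n) (\<gamma> (m + n) - \<gamma> m - \<gamma> n)"
      by (simp add: \<Lambda>_var linear_form_def algebra_simps)
    also have "\<dots> \<in> A"
    proof (rule syzygy_in_A)
      have "(\<alpha> (m + n) - \<alpha> m - \<alpha> n) * f\<^sub>1 + (\<beta> (m + n) - \<beta> m - \<beta> n) * f\<^sub>2
          + (\<gamma> (m + n) - \<gamma> m - \<gamma> n) * f\<^sub>3
        = (\<alpha> (m + n) * f\<^sub>1 + \<beta> (m + n) * f\<^sub>2 + \<gamma> (m + n) * f\<^sub>3)
          - (\<alpha> m * f\<^sub>1 + \<beta> m * f\<^sub>2 + \<gamma> m * f\<^sub>3) - (\<alpha> n * f\<^sub>1 + \<beta> n * f\<^sub>2 + \<gamma> n * f\<^sub>3)"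
        by (simp add: algebra_simps)
      also have "\<dots> = 0"
        using coeffs[OF mn(1)] coeffs[OF mn(2)] coeffs[OF add_in[OF mn]] by simp
      finally show "(\<alpha> (m + n) - \<alpha> m - \<alpha> n) * f\<^sub>1 + (\<beta> (m + n) - \<beta> m - \<beta> n) * f\<^sub>2
          + (\<gamma> (m + n) - \<gamma> m - \<gamma> n) * f\<^sub>3 = 0" .
    qed
    finally show "\<Lambda> (sym_var (m + n)) - \<Lambda> (sym_var m) - \<Lambda> (sym_var n) \<in> A" .
  next
    fix r m assume m: "m \<in> J"
    have "\<Lambda> (sym_var (r * m)) - \<Lambda> (sym_const r) * \<Lambda> (sym_var m) =
      linear_form (\<alpha> (r * m) - r * \<alpha> m) (\<beta> (r * m) - r * \<beta> m) (\<gamma> (r * m) - r * \<gamma> m)"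
      by (simp add: \<Lambda>_var \<Lambda>_const linear_form_def algebra_simps)
    also have "\<dots> \<in> A"
    proof (rule syzygy_in_A)
      have "(\<alpha> (r * m) - r * \<alpha> m) * f\<^sub>1 + (\<beta> (r * m) - r * \<beta> m) * f\<^sub>2 + (\<gamma> (r * m) - r * \<gamma> m) * f\<^sub>3
        = (\<alpha> (r * m) * f\<^sub>1 + \<beta> (r * m) * f\<^sub>2 + \<gamma> (r * m) * f\<^sub>3) - r * (\<alpha> m * f\<^sub>1 + \<beta> m * f\<^sub>2 + \<gamma> m * f\<^sub>3)"
        by (simp add: algebra_simps)
      also have "\<dots> = 0"
        using coeffs[OF m] coeffs[OF mult_in[OF m, of r]] by simp
      finally show "(\<alpha> (r * m) - r * \<alpha> m) * f\<^sub>1 + (\<beta> (r * m) - r * \<beta> m) * f\<^sub>2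
        + (\<gamma> (r * m) - r * \<gamma> m) * f\<^sub>3 = 0" .
    qed
    finally show "\<Lambda> (sym_var (r * m)) - \<Lambda> (sym_const r) * \<Lambda> (sym_var m) \<in> A" .
  qed

  define \<iota> where "\<iota> = subst3 sym_const (sym_var f\<^sub>3) (sym_var f\<^sub>2) (sym_var f\<^sub>1 :: ('r \<Rightarrow>\<^sub>0 nat) \<Rightarrow>\<^sub>0 'r)"
  have hom_sym_const: "comm_hom (sym_const :: 'r \<Rightarrow> ('r \<Rightarrow>\<^sub>0 nat) \<Rightarrow>\<^sub>0 'r)"
    by unfold_locales (simp_all add: sym_const_def single_add mult_single)
  interpret sym_const: comm_hom "sym_const :: 'r \<Rightarrow> ('r \<Rightarrow>\<^sub>0 nat) \<Rightarrow>\<^sub>0 'r"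
    by (rule hom_sym_const)
  interpret \<iota>: comm_hom \<iota>
    unfolding \<iota>_def by (rule comm_hom_subst3[OF hom_sym_const])
  have \<iota>_simps [simp]: "\<iota> (const3 r) = sym_const r" "\<iota> T\<^sub>1 = sym_var f\<^sub>1" "\<iota> T\<^sub>2 = sym_var f\<^sub>2"
    "\<iota> T\<^sub>3 = sym_var f\<^sub>3" for r
    by (simp_all add: \<iota>_def subst3_simps hom_sym_const)
  have \<iota>_over: "\<iota> g \<in> polys_over J" for g
    by (induction g rule: poly3_induct)
      (simp_all add: polys_over_add polys_over_mult sym_var_in_polys_over f_in)
  have var_lin: "\<iota> (linear_form a b c) - sym_var m \<in> Rel"
    if m: "m = a * f\<^sub>1 + b * f\<^sub>2 + c * f\<^sub>3" for a b c m
  proof -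
    have J: "a * f\<^sub>1 \<in> J" "b * f\<^sub>2 \<in> J" "c * f\<^sub>3 \<in> J" "a * f\<^sub>1 + b * f\<^sub>2 \<in> J"
      by (auto intro: add_in mult_in f_in)
    have "(sym_var m - sym_var (a * f\<^sub>1 + b * f\<^sub>2) - sym_var (c * f\<^sub>3))
      + (sym_var (a * f\<^sub>1 + b * f\<^sub>2) - sym_var (a * f\<^sub>1) - sym_var (b * f\<^sub>2))
      + (sym_var (a * f\<^sub>1) - sym_const a * sym_var f\<^sub>1)
      + (sym_var (b * f\<^sub>2) - sym_const b * sym_var f\<^sub>2)
      + (sym_var (c * f\<^sub>3) - sym_const c * sym_var f\<^sub>3) \<in> Rel" (is "?r \<in> _")
      unfolding m by (intro Rel_add Rel_var_add Rel_var_mult J f_in)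
    moreover have "\<iota> (linear_form a b c) - sym_var m = - ?r"
      by (simp add: linear_form_def)
    ultimately show ?thesis
      using Rel_uminus by metis
  qed
  have "sym_var 0 \<in> Rel"
    using Rel_var_mult[of 0 0] by simp
  then have syz_Rel: "\<iota> (linear_form a b c) \<in> Rel" if "a * f\<^sub>1 + b * f\<^sub>2 + c * f\<^sub>3 = 0" for a b c
    using Rel_add[OF var_lin[of 0 a b c]] that by fastforce
  have \<iota>_A: "\<iota> g \<in> Rel" if "g \<in> A" for g
    using that syz_Rel[OF syz\<^sub>1] syz_Rel[OF syz\<^sub>2]
    by (auto simp: A_def L\<^sub>1_def L\<^sub>2_def intro!: Rel_add Rel_mult \<iota>_over)

  have \<iota>\<Lambda>: "\<iota> (\<Lambda> p) - p \<in> Rel" if "p \<in> polys_over J" for p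
    using that
  proof (induction p rule: polys_over_induct)
    case (const c)
    show ?case by (simp add: \<Lambda>_const)
  next
    case (add p q)
    then show ?case
      using Rel_add[OF add.IH] by (simp add: algebra_simps)
  next
    case (var p m)
    have "\<iota> (\<Lambda> (p * sym_var m)) - p * sym_var m =
      \<iota> (\<Lambda> (sym_var m)) * (\<iota> (\<Lambda> p) - p) + p * (\<iota> (\<Lambda> (sym_var m)) - sym_var m)"
      by (simp add: algebra_simps)
    also have "\<dots> \<in> Rel"
      unfolding \<Lambda>_var using var
      by (intro Rel_add Rel_mult \<iota>_over var_lin coeffs)
    finally show ?case .
  qed
  have \<Lambda>\<iota>: "\<Lambda> (\<iota> g) - g \<in> A" for g
  proof (induction g rule: poly3_induct)
    case (const c)
    show ?case by (simp add: \<Lambda>_const A_0)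
  next
    case (add p q)
    then show ?case
      using A_add[of "\<Lambda> (\<iota> p) - p" "\<Lambda> (\<iota> q) - q"] by (simp add: algebra_simps)
  next
    have step: "\<Lambda> (\<iota> (v * p)) - v * p \<in> A" if "\<Lambda> (\<iota> p) - p \<in> A" "\<Lambda> (\<iota> v) - v \<in> A" for v p
    proof -
      have "\<Lambda> (\<iota> (v * p)) - v * p = \<Lambda> (\<iota> v) * (\<Lambda> (\<iota> p) - p) + p * (\<Lambda> (\<iota> v) - v)"
        by (simp add: algebra_simps)
      then show ?thesis
        using that by (simp add: A_add A_mult)
    qed
    have diff: "linear_form a b c - linear_form a' b' c' = linear_form (a - a') (b - b') (c - c')"
      for a b c a' b' c' :: 'r
      by (simp add: linear_form_def algebra_simps)
    {
      case (varX p)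
      have "\<Lambda> (\<iota> T\<^sub>3) - T\<^sub>3 = linear_form (\<alpha> f\<^sub>3) (\<beta> f\<^sub>3) (\<gamma> f\<^sub>3) - linear_form 0 0 1"
        by (simp add: \<Lambda>_var) (simp add: linear_form_def)
      also have "\<dots> \<in> A"
        unfolding diff using coeffs[OF f_in(3)] by (intro syzygy_in_A) (simp add: algebra_simps)
      finally show ?case using varX by (intro step)
    next
      case (varY p)
      have "\<Lambda> (\<iota> T\<^sub>2) - T\<^sub>2 = linear_form (\<alpha> f\<^sub>2) (\<beta> f\<^sub>2) (\<gamma> f\<^sub>2) - linear_form 0 1 0"
        by (simp add: \<Lambda>_var) (simp add: linear_form_def)
      also have "\<dots> \<in> A"
        unfolding diff using coeffs[OF f_in(2)] by (intro syzygy_in_A) (simp add: algebra_simps)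
      finally show ?case using varY by (intro step)
    next
      case (varZ p)
      have "\<Lambda> (\<iota> T\<^sub>1) - T\<^sub>1 = linear_form (\<alpha> f\<^sub>1) (\<beta> f\<^sub>1) (\<gamma> f\<^sub>1) - linear_form 1 0 0"
        by (simp add: \<Lambda>_var) (simp add: linear_form_def)
      also have "\<dots> \<in> A"
        unfolding diff using coeffs[OF f_in(1)] by (intro syzygy_in_A) (simp add: algebra_simps)
      finally show ?case using varZ by (intro step)
    }
  qed

  have rees_\<iota>: "rees_eval (\<iota> g) = rees_map f\<^sub>1 f\<^sub>2 f\<^sub>3 g" for g
    unfolding rees_map_def
    by (rule comm_hom_poly3_unique)
      (simp_all add: comm_hom_compose[OF comm_hom_rees_eval \<iota>.comm_hom_axioms]
        comm_hom_subst3 comm_hom_const subst3_simps)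
  interpret rees: comm_hom "rees_eval :: (('r \<Rightarrow>\<^sub>0 nat) \<Rightarrow>\<^sub>0 'r) \<Rightarrow> 'r poly"
    by (rule comm_hom_rees_eval)
  have rees_\<Lambda>: "rees_map f\<^sub>1 f\<^sub>2 f\<^sub>3 (\<Lambda> p) = rees_eval p" if "p \<in> polys_over J" for p
  proof -
    have "rees_eval (\<iota> (\<Lambda> p) - p) = 0"
      by (rule Rel_subset_kernel[OF \<iota>\<Lambda>[OF that]])
    then show ?thesis by (simp add: rees_\<iota>)
  qed

  have "(\<forall>p\<in>polys_over J. rees_eval p = 0 \<longrightarrow> p \<in> Rel) \<longleftrightarrow> (\<forall>g. rees_map f\<^sub>1 f\<^sub>2 f\<^sub>3 g = 0 \<longrightarrow> g \<in> A)"
  proof (intro iffI allI ballI impI)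
    fix g assume "\<forall>p\<in>polys_over J. rees_eval p = 0 \<longrightarrow> p \<in> Rel" and g: "rees_map f\<^sub>1 f\<^sub>2 f\<^sub>3 g = 0"
    then have "\<iota> g \<in> Rel"
      using \<iota>_over rees_\<iota> by metis
    then have "\<Lambda> (\<iota> g) - (\<Lambda> (\<iota> g) - g) \<in> A"
      by (intro A_diff \<Lambda>_Rel \<Lambda>\<iota>)
    then show "g \<in> A" by simp
  next
    fix p assume *: "\<forall>g. rees_map f\<^sub>1 f\<^sub>2 f\<^sub>3 g = 0 \<longrightarrow> g \<in> A" and p: "p \<in> polys_over J" "rees_eval p = 0"
    then have "\<Lambda> p \<in> A"
      by (simp add: rees_\<Lambda>)
    then have "\<iota> (\<Lambda> p) - (\<iota> (\<Lambda> p) - p) \<in> Rel"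
      using p by (intro Rel_diff \<iota>_A \<iota>\<Lambda>)
    then show "p \<in> Rel" by simp
  qed
  then show ?thesis
    using linear_type_iff_kernel unfolding J_def A_def L\<^sub>1_def L\<^sub>2_def by simp
qed

section \<open>Derivations of \<open>K[x,y,z]\<close>\<close>

locale ring_derivation =
  fixes D :: "'a::comm_ring_1 \<Rightarrow> 'a"
  assumes add [simp]: "D (p + q) = D p + D q"
    and mult [simp]: "D (p * q) = D p * q + p * D q"
begin

lemma zero [simp]: "D 0 = 0"
  using add[of 0 0] by simp

lemma one [simp]: "D 1 = 0"
  using mult[of 1 1] by simp

lemma power: "D (p ^ m) = of_nat m * p ^ (m - 1) * D p"
proof (induction m)
  case (Suc m)
  then show ?case
    by (cases m) (simp_all add: algebra_simps)
qed simp

lemma D_sum: "D (sum f A) = (\<Sum>x\<in>A. D (f x))"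
  by (induction A rule: infinite_finite_induct) simp_all

end

lemma ring_derivation_map_poly:
  assumes "ring_derivation D"
  shows "ring_derivation (map_poly D)"
proof -
  interpret ring_derivation D by fact
  show ?thesis
    by unfold_locales (simp_all add: poly_eq_iff coeff_map_poly coeff_mult D_sum sum.distrib)
qed

lemma ring_derivation_pderiv: "ring_derivation (pderiv :: 'a::idom poly \<Rightarrow> 'a poly)"
  by unfold_locales (simp_all add: pderiv_add pderiv_mult algebra_simps)

context
begin

interpretation dX: ring_derivation "dX :: 'k::idom poly3 \<Rightarrow> 'k poly3"
  unfolding dX_def by (intro ring_derivation_map_poly ring_derivation_pderiv)
interpretation dY: ring_derivation "dY :: 'k::idom poly3 \<Rightarrow> 'k poly3"
  unfolding dY_def by (intro ring_derivation_map_poly ring_derivation_pderiv)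
interpretation dZ: ring_derivation "dZ :: 'k::idom poly3 \<Rightarrow> 'k poly3"
  unfolding dZ_def by (rule ring_derivation_pderiv)

lemma partial_derivative_simps [simp]:
  fixes p q :: "'k::idom poly3"
  shows "dX (p + q) = dX p + dX q" "dX (p * q) = dX p * q + p * dX q"
    "dX (p ^ m) = of_nat m * p ^ (m - 1) * dX p"
    "dX (const3 c) = 0" "dX varX = 1" "dX varY = 0" "dX varZ = 0"
    "dY (p + q) = dY p + dY q" "dY (p * q) = dY p * q + p * dY q"
    "dY (p ^ m) = of_nat m * p ^ (m - 1) * dY p"
    "dY (const3 c) = 0" "dY varX = 0" "dY varY = 1" "dY varZ = 0"
    "dZ (p + q) = dZ p + dZ q" "dZ (p * q) = dZ p * q + p * dZ q"
    "dZ (p ^ m) = of_nat m * p ^ (m - 1) * dZ p"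
    "dZ (const3 c) = 0" "dZ varX = 0" "dZ varY = 0" "dZ varZ = 1"
  by (simp_all add: dX.power dY.power dZ.power)
    (simp_all add: dX_def dY_def dZ_def const3_def varX_def varY_def varZ_def
      map_poly_pCons pderiv_pCons one_pCons)

end

definition vector_field :: "'k::idom poly3 \<Rightarrow> 'k poly3 \<Rightarrow> 'k poly3 \<Rightarrow> 'k poly3 \<Rightarrow> 'k poly3" where
  "vector_field a b c = (\<lambda>p. a * dX p + b * dY p + c * dZ p)"

lemma is_derivation_vector_field: "is_derivation (vector_field a b c)"
  by (simp add: is_derivation_def vector_field_def algebra_simps)

lemma vector_field_vars [simp]:
  "vector_field a b c varX = a" "vector_field a b c varY = b" "vector_field a b c varZ = c"
  by (simp_all add: vector_field_def)

text \<open>A derivation over \<open>K\<close> kills the constants, so the product rule determines it by its values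
  on the variables.\<close>

lemma derivation_eq_vector_field:
  fixes \<theta> :: "'k::idom poly3 \<Rightarrow> 'k poly3"
  assumes "is_derivation \<theta>"
  shows "\<theta> = vector_field (\<theta> varX) (\<theta> varY) (\<theta> varZ)"
proof
  interpret ring_derivation \<theta>
    using assms unfolding is_derivation_def by unfold_locales blast+
  have "\<theta> (const3 c * 1) = const3 c * \<theta> 1" for c
    using assms unfolding is_derivation_def by blast
  then have const: "\<theta> (const3 c) = 0" for c
    by (simp only: mult_1_right one mult_zero_right)
  fix p
  show "\<theta> p = vector_field (\<theta> varX) (\<theta> varY) (\<theta> varZ) p"
    by (induction p rule: poly3_induct)
      (simp_all add: const vector_field_def algebra_simps)
qed

lemma log_derivations_iff:
  "\<theta> \<in> log_derivations F \<longleftrightarrow> is_derivation \<theta> \<and> (\<exists>r. \<theta> F = r * F)"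
  by (simp add: log_derivations_def genideal_type_algebra_singleton)

lemma subspace_log_derivations: "fun_module.subspace (log_derivations F)"
proof (rule fun_module.subspaceI)
  show "0 \<in> log_derivations F"
    by (auto simp: log_derivations_iff is_derivation_def intro: exI[of _ 0])
next
  fix \<theta> \<eta> assume "\<theta> \<in> log_derivations F" "\<eta> \<in> log_derivations F"
  then obtain r s where "is_derivation \<theta>" "\<theta> F = r * F" "is_derivation \<eta>" "\<eta> F = s * F"
    by (auto simp: log_derivations_iff)
  then show "\<theta> + \<eta> \<in> log_derivations F"
    by (auto simp: log_derivations_iff is_derivation_def algebra_simps intro!: exI[of _ "r + s"])
next
  fix c \<theta> assume "\<theta> \<in> log_derivations F"
  then obtain r where "is_derivation \<theta>" "\<theta> F = r * F"
    by (auto simp: log_derivations_iff)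
  then show "fun_scale c \<theta> \<in> log_derivations F"
    by (auto simp: log_derivations_iff is_derivation_def fun_scale_def algebra_simps
        intro!: exI[of _ "c * r"])
qed

section \<open>Prime elements as generators of kernels\<close>

lemma kernel_generated_by_dvd_iff:
  assumes "kernel_generated_by h x 0"
  shows "x dvd c \<longleftrightarrow> h c = 0"
proof -
  interpret comm_hom h using assms by (simp add: kernel_generated_by_def)
  show ?thesis using assms by (auto simp: kernel_generated_by_def dvd_def)
qed

lemma prime_elem_kernel_generator:
  fixes h :: "'a::idom \<Rightarrow> 'b::idom"
  assumes h: "kernel_generated_by h x 0" and "x \<noteq> 0"
  shows "prime_elem x"
proof -
  interpret comm_hom h using h by (simp add: kernel_generated_by_def)
  show ?thesis
    using \<open>x \<noteq> 0\<close> unfolding prime_elem_def by (auto simp: kernel_generated_by_dvd_iff[OF h])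
qed

lemma kernel_coeff_0: "kernel_generated_by (\<lambda>c. coeff c 0) [:0, 1:] (0 :: 'a::comm_ring_1 poly)"
proof -
  have "\<exists>a b. c = [:0, 1:] * a + 0 * b" if "coeff c 0 = 0" for c :: "'a poly"
    using that by (cases c) auto
  then show ?thesis
    by (auto simp: kernel_generated_by_def comm_hom_coeff_0)
qed

definition mod_varY :: "'k::comm_ring_1 poly3 \<Rightarrow> 'k poly poly" where
  "mod_varY = map_poly (\<lambda>c. coeff c 0)"

lemma kernel_mod_varY: "kernel_generated_by mod_varY varY (0 :: 'k::comm_ring_1 poly3)"
  using kernel_generated_by_map_poly[OF kernel_coeff_0] by (simp add: mod_varY_def varY_def)

lemma mod_varY_simps [simp]:
  "mod_varY varX = [:[:0, 1:]:]" "mod_varY varY = 0" "mod_varY varZ = [:0, 1:]"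
  "mod_varY (const3 c) = [:[:c:]:]"
  by (simp_all add: mod_varY_def varX_def varY_def varZ_def const3_def map_poly_pCons)

lemma prime_elem_varY: "prime_elem (varY :: 'k::idom poly3)"
  by (rule prime_elem_kernel_generator[OF kernel_mod_varY]) (simp add: varY_def)

section \<open>Syzygies of the gradient\<close>

locale rational_curve =
  fixes a\<^sub>1 a\<^sub>2 a\<^sub>3 a\<^sub>4 :: "'k::{alg_closed_field, field_char_0}" and n :: nat
  assumes a\<^sub>1: "a\<^sub>1 \<noteq> 0" and a\<^sub>2: "a\<^sub>2 \<noteq> 0"
begin

abbreviation "x \<equiv> varX :: 'k poly3"
abbreviation "y \<equiv> varY :: 'k poly3"
abbreviation "z \<equiv> varZ :: 'k poly3"

text \<open>In the coordinates \<open>x, y, w\<close> the terms with \<open>a\<^sub>3\<close> and \<open>a\<^sub>4\<close> disappear.\<close>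

definition "w = z + const3 a\<^sub>3 * x + const3 a\<^sub>4 * y"
definition "F = y ^ (n + 4) * z + const3 a\<^sub>1 * x ^ (n + 5) + const3 a\<^sub>2 * x ^ 2 * y ^ (n + 3)
  + const3 a\<^sub>3 * x * y ^ (n + 4) + const3 a\<^sub>4 * y ^ (n + 5)"

text \<open>These are the coefficients of the partial derivatives. The constant \<open>\<kappa>\<close> is chosen such that
  \<open>\<kappa> \<gamma>\<^sup>2 = \<alpha>\<close>, so that the first entry of the second syzygy is exactly \<open>y\<^bsup>n+2\<^esup>\<close>.\<close>

definition "\<alpha> = of_nat (n + 5) * a\<^sub>1"
definition "\<delta> = 2 * a\<^sub>2"
definition "\<epsilon> = (of_nat (n + 4) :: 'k)"
definition "\<gamma> = of_nat (n + 3) * a\<^sub>2"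
definition "\<kappa> = \<alpha> / \<gamma> ^ 2"

lemma nonzero [simp]: "\<alpha> \<noteq> 0" "\<gamma> \<noteq> 0" "\<epsilon> \<noteq> 0" "\<kappa> \<noteq> 0"
proof -
  show *: "\<alpha> \<noteq> 0" "\<gamma> \<noteq> 0"
    using a\<^sub>1 a\<^sub>2 by (simp_all add: \<alpha>_def \<gamma>_def del: of_nat_add)
  show "\<epsilon> \<noteq> 0"
    unfolding \<epsilon>_def by (simp del: of_nat_add)
  show "\<kappa> \<noteq> 0"
    using * by (simp add: \<kappa>_def)
qed

text \<open>The polynomials \<open>f\<^sub>1, f\<^sub>2, f\<^sub>3\<close> are the partial derivatives of \<open>F\<close> with respect to the
  coordinates \<open>x, y, w\<close>.\<close>

definition "Q = const3 \<epsilon> * y * w + const3 \<gamma> * x ^ 2"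
definition "f\<^sub>1 = const3 \<alpha> * x ^ (n + 4) + const3 \<delta> * x * y ^ (n + 3)"
definition "f\<^sub>2 = y ^ (n + 2) * Q"
definition "f\<^sub>3 = y ^ (n + 4)"

text \<open>The identity \<open>(\<gamma> x\<^sup>2 - \<epsilon> y w) Q = \<gamma>\<^sup>2 x\<^sup>4 - \<epsilon>\<^sup>2 y\<^sup>2 w\<^sup>2\<close> expresses \<open>x\<^sup>4\<close>, hence
  \<open>f\<^sub>1\<close>, through \<open>Q\<close> and \<open>y\<^sup>2\<close>; \<open>p\<^sub>2\<close> and \<open>q\<^sub>2\<close> are the resulting coefficients in
  \<open>y\<^bsup>n+2\<^esup> f\<^sub>1 = p\<^sub>2 f\<^sub>2 + q\<^sub>2 f\<^sub>3\<close>.\<close>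

definition "p\<^sub>2 = const3 \<kappa> * x ^ n * (const3 \<gamma> * x ^ 2 - const3 \<epsilon> * y * w)"
definition "q\<^sub>2 = const3 \<kappa> * const3 \<epsilon> ^ 2 * x ^ n * w ^ 2 + const3 \<delta> * x * y ^ (n + 1)"

interpretation const3: comm_hom "const3 :: 'k \<Rightarrow> 'k poly3"
  by (rule comm_hom_const3)

lemma const3_kappa: "const3 \<kappa> * const3 \<gamma> ^ 2 = const3 \<alpha>"
  by (simp add: \<kappa>_def flip: const3.mult const3.power)

lemma dX_F: "dX F = f\<^sub>1 + const3 a\<^sub>3 * f\<^sub>3"
  and dY_F: "dY F = f\<^sub>2 + const3 a\<^sub>4 * f\<^sub>3"
  and dZ_F: "dZ F = f\<^sub>3"
  unfolding F_def f\<^sub>1_def f\<^sub>2_def f\<^sub>3_def Q_def w_def \<alpha>_def \<delta>_def \<epsilon>_def \<gamma>_def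
  by (simp_all, simp_all add: power_add algebra_simps eval_nat_numeral)

lemma gradient_ideal_F: "gradient_ideal F = {a * f\<^sub>1 + b * f\<^sub>2 + c * f\<^sub>3 | a b c. True}"
proof -
  have "(\<exists>a b c. p = a * dX F + b * dY F + c * dZ F) \<longleftrightarrow> (\<exists>a b c. p = a * f\<^sub>1 + b * f\<^sub>2 + c * f\<^sub>3)" for p
  proof safe
    fix a b c
    show "\<exists>a' b' c'. a * dX F + b * dY F + c * dZ F = a' * f\<^sub>1 + b' * f\<^sub>2 + c' * f\<^sub>3"
      by (intro exI[of _ a] exI[of _ b] exI[of _ "c + a * const3 a\<^sub>3 + b * const3 a\<^sub>4"])
        (simp add: dX_F dY_F dZ_F algebra_simps)
    show "\<exists>a' b' c'. a * f\<^sub>1 + b * f\<^sub>2 + c * f\<^sub>3 = a' * dX F + b' * dY F + c' * dZ F"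
      by (intro exI[of _ a] exI[of _ b] exI[of _ "c - a * const3 a\<^sub>3 - b * const3 a\<^sub>4"])
        (simp add: dX_F dY_F dZ_F algebra_simps)
  qed
  then show ?thesis
    by (simp add: gradient_ideal_def genideal_type_algebra_insert3)
qed

lemma euler: "x * dX F + y * dY F + z * dZ F = const3 (of_nat (n + 5)) * F"
  unfolding F_def
  by (simp, simp add: power_add algebra_simps eval_nat_numeral)

lemma syzygy\<^sub>1: "0 * f\<^sub>1 + y ^ 2 * f\<^sub>2 + (- Q) * f\<^sub>3 = 0"
  by (simp add: f\<^sub>2_def f\<^sub>3_def power_add algebra_simps eval_nat_numeral)

lemma syzygy\<^sub>2: "y ^ (n + 2) * f\<^sub>1 + (- p\<^sub>2) * f\<^sub>2 + (- q\<^sub>2) * f\<^sub>3 = 0"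
  unfolding f\<^sub>1_def f\<^sub>2_def f\<^sub>3_def p\<^sub>2_def q\<^sub>2_def Q_def const3_kappa[symmetric]
  by (simp add: power_add algebra_simps eval_nat_numeral)

interpretation mod_varY: comm_hom "mod_varY :: 'k poly3 \<Rightarrow> 'k poly poly"
  using kernel_mod_varY unfolding kernel_generated_by_def by blast

lemma not_Y_dvd: "\<not> y dvd f\<^sub>1" "\<not> y dvd Q"
  by (simp_all add: kernel_generated_by_dvd_iff[OF kernel_mod_varY] f\<^sub>1_def Q_def zero_power)

text \<open>The generators \<open>f\<^sub>2\<close> and \<open>f\<^sub>3\<close> are divisible by \<open>y\<^bsup>n+2\<^esup>\<close> while \<open>f\<^sub>1\<close> is not divisible
  by the prime \<open>y\<close>, so the first entry of a syzygy is a multiple of \<open>y\<^bsup>n+2\<^esup>\<close> and can be removed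
  with the second basic syzygy. What remains is a relation between \<open>Q\<close> and \<open>y\<^sup>2\<close>, which are
  coprime.\<close>

lemma syzygies_generated:
  assumes syz: "a * f\<^sub>1 + b * f\<^sub>2 + c * f\<^sub>3 = 0"
  shows "\<exists>u v. a = u * 0 + v * y ^ (n + 2) \<and> b = u * y ^ 2 + v * (- p\<^sub>2) \<and> c = u * (- Q) + v * (- q\<^sub>2)"
proof -
  have Y0: "y \<noteq> 0" by (simp add: varY_def)
  have "f\<^sub>1 * a = - (b * f\<^sub>2 + c * f\<^sub>3)"
    using syz by (simp add: algebra_simps eq_neg_iff_add_eq_0)
  also have "\<dots> = y ^ (n + 2) * (- (b * Q + c * y ^ 2))"
    by (simp add: f\<^sub>2_def f\<^sub>3_def power_add algebra_simps eval_nat_numeral)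
  finally have "y ^ (n + 2) dvd f\<^sub>1 * a" by simp
  then have "y ^ (n + 2) dvd a"
    by (rule prime_power_dvd_multD[OF prime_elem_varY]) (simp_all add: not_Y_dvd)
  then obtain v where v: "a = v * y ^ (n + 2)"
    by (metis dvd_def mult.commute)
  have "y ^ (n + 2) * ((b + v * p\<^sub>2) * Q + (c + v * q\<^sub>2) * y ^ 2)
      = (a * f\<^sub>1 + b * f\<^sub>2 + c * f\<^sub>3) - v * (y ^ (n + 2) * f\<^sub>1 + (- p\<^sub>2) * f\<^sub>2 + (- q\<^sub>2) * f\<^sub>3)"
    by (simp add: v f\<^sub>2_def f\<^sub>3_def power_add algebra_simps eval_nat_numeral)
  also have "\<dots> = 0"
    by (simp only: syz syzygy\<^sub>2 mult_zero_right diff_zero)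
  finally have eq: "(b + v * p\<^sub>2) * Q + (c + v * q\<^sub>2) * y ^ 2 = 0"
    using Y0 by simp
  then have "Q * (b + v * p\<^sub>2) = y ^ 2 * (- (c + v * q\<^sub>2))"
    by (simp add: algebra_simps eq_neg_iff_add_eq_0)
  then have "y ^ 2 dvd Q * (b + v * p\<^sub>2)" by simp
  then have "y ^ 2 dvd b + v * p\<^sub>2"
    by (rule prime_power_dvd_multD[OF prime_elem_varY]) (simp_all add: not_Y_dvd)
  then obtain u where u: "b + v * p\<^sub>2 = u * y ^ 2"
    by (metis dvd_def mult.commute)
  with eq have "y ^ 2 * (u * Q + (c + v * q\<^sub>2)) = 0"
    by (simp add: algebra_simps)
  then have "u * Q + (c + v * q\<^sub>2) = 0"
    using Y0 by simp
  then have "c = u * (- Q) + v * (- q\<^sub>2)"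
    by (simp add: algebra_simps eq_neg_iff_add_eq_0)
  moreover have "b = u * y ^ 2 + v * (- p\<^sub>2)"
    using u by (simp add: algebra_simps)
  ultimately show ?thesis
    using v by auto
qed

section \<open>Freeness of the logarithmic derivations\<close>

text \<open>The vector field \<open>a \<partial>\<^sub>x + b \<partial>\<^sub>y + c \<partial>\<^sub>w\<close> with respect to the coordinates \<open>x, y, w\<close>: the
  correction in the third entry makes \<open>c\<close> its value on \<open>w\<close>. It annihilates \<open>F\<close> exactly if
  \<open>(a, b, c)\<close> is a syzygy.\<close>

definition tangent_field :: "'k poly3 \<Rightarrow> 'k poly3 \<Rightarrow> 'k poly3 \<Rightarrow> 'k poly3 \<Rightarrow> 'k poly3" where
  "tangent_field a b c = vector_field a b (c - const3 a\<^sub>3 * a - const3 a\<^sub>4 * b)"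

lemma tangent_field_F: "tangent_field a b c F = a * f\<^sub>1 + b * f\<^sub>2 + c * f\<^sub>3"
  by (simp add: tangent_field_def vector_field_def dX_F dY_F dZ_F algebra_simps)

definition "euler_field = vector_field x y z"
definition "\<theta>\<^sub>1 = tangent_field 0 (y ^ 2) (- Q)"
definition "\<theta>\<^sub>2 = tangent_field (y ^ (n + 2)) (- p\<^sub>2) (- q\<^sub>2)"

lemma euler_field_F: "euler_field F = const3 (of_nat (n + 5)) * F"
  by (simp add: euler_field_def vector_field_def euler)

lemma \<theta>_F [simp]: "\<theta>\<^sub>1 F = 0" "\<theta>\<^sub>2 F = 0"
  by (simp_all only: \<theta>\<^sub>1_def \<theta>\<^sub>2_def tangent_field_F syzygy\<^sub>1 syzygy\<^sub>2)

lemma F_nonzero: "F \<noteq> 0"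
proof
  assume "F = 0"
  then have "mod_varY F = 0" by simp
  then show False using a\<^sub>1 by (simp add: F_def zero_power)
qed

lemma euler_field_F_nonzero: "euler_field F \<noteq> 0"
  unfolding euler_field_F using F_nonzero by (simp add: const3_def del: of_nat_add)

lemma basis_in_log_derivations:
  "euler_field \<in> log_derivations F" "\<theta>\<^sub>1 \<in> log_derivations F" "\<theta>\<^sub>2 \<in> log_derivations F"
proof -
  show "euler_field \<in> log_derivations F"
    unfolding log_derivations_iff euler_field_F
    by (auto simp: euler_field_def is_derivation_vector_field)
  show "\<theta>\<^sub>1 \<in> log_derivations F" "\<theta>\<^sub>2 \<in> log_derivations F"
    unfolding log_derivations_iff \<theta>_F
    by (auto simp: \<theta>\<^sub>1_def \<theta>\<^sub>2_def tangent_field_def is_derivation_vector_field intro!: exI[of _ 0])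
qed

text \<open>The Euler field is separated from the other two by its value on \<open>F\<close>, and these by their
  values on \<open>x\<close> and \<open>y\<close>.\<close>

lemma independent_basis: "fun_module.independent {euler_field, \<theta>\<^sub>1, \<theta>\<^sub>2}"
proof -
  have Y0: "y \<noteq> 0" by (simp add: varY_def)
  have "\<theta>\<^sub>1 x = 0" "\<theta>\<^sub>1 y = y ^ 2" "\<theta>\<^sub>2 x = y ^ (n + 2)"
    by (simp_all add: \<theta>\<^sub>1_def \<theta>\<^sub>2_def tangent_field_def)
  note at = this
  have distinct: "\<theta>\<^sub>1 \<noteq> \<theta>\<^sub>2" "euler_field \<notin> {\<theta>\<^sub>1, \<theta>\<^sub>2}"
    using at Y0 euler_field_F_nonzero \<theta>_F by (metis power_not_zero, metis empty_iff insert_iff)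
  have "u euler_field = 0 \<and> u \<theta>\<^sub>1 = 0 \<and> u \<theta>\<^sub>2 = 0"
    if "(\<Sum>v\<in>{euler_field, \<theta>\<^sub>1, \<theta>\<^sub>2}. fun_scale (u v) v) = 0" for u
  proof -
    from that distinct
    have sum: "u euler_field * euler_field p + u \<theta>\<^sub>1 * \<theta>\<^sub>1 p + u \<theta>\<^sub>2 * \<theta>\<^sub>2 p = 0" for p
      by (simp add: fun_scale_def fun_eq_iff add.assoc)
    have E: "u euler_field = 0"
      using sum[of F] euler_field_F_nonzero by simp
    moreover have "u \<theta>\<^sub>2 = 0"
      using sum[of x] E at Y0 by simp
    ultimately show ?thesis
      using sum[of y] at Y0 by simp
  qed
  then show ?thesis
    by (subst fun_module.dependent_finite) auto
qed

text \<open>Dividing by the degree requires characteristic zero: subtracting \<open>r/d\<close> times the Euler field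
  turns a logarithmic derivation into a syzygy.\<close>

lemma log_derivation_in_span:
  assumes "\<theta> \<in> log_derivations F"
  shows "\<theta> \<in> fun_module.span {euler_field, \<theta>\<^sub>1, \<theta>\<^sub>2}"
proof -
  from assms obtain r where \<theta>: "is_derivation \<theta>" "\<theta> F = r * F"
    by (auto simp: log_derivations_iff)
  define s where "s = r * const3 (1 / of_nat (n + 5))"
  define a where "a = \<theta> x - s * x"
  define b where "b = \<theta> y - s * y"
  \<comment> \<open>The value on \<open>w\<close> of \<open>\<theta> - s E\<close>, where \<open>E\<close> is the Euler field.\<close>
  define c where "c = \<theta> z - s * z + const3 a\<^sub>3 * a + const3 a\<^sub>4 * b"
  have \<theta>_eq: "\<theta> = fun_scale s euler_field + tangent_field a b c"
    by (subst derivation_eq_vector_field[OF \<theta>(1)])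
      (simp add: fun_eq_iff fun_scale_def euler_field_def tangent_field_def vector_field_def
        a_def b_def c_def algebra_simps)
  have "const3 (1 / of_nat (n + 5)) * const3 (of_nat (n + 5)) = (1 :: 'k poly3)"
    by (simp del: of_nat_add const3.of_nat add: of_nat_eq_0_iff flip: const3.mult)
  then have "s * euler_field F = r * F"
    by (simp add: s_def euler_field_F mult.assoc del: const3.of_nat)
  then have "a * f\<^sub>1 + b * f\<^sub>2 + c * f\<^sub>3 = 0"
    using \<theta>(2) fun_cong[OF \<theta>_eq, of F] by (simp add: fun_scale_def tangent_field_F)
  from syzygies_generated[OF this] obtain u v
    where "a = u * 0 + v * y ^ (n + 2)" "b = u * y ^ 2 + v * (- p\<^sub>2)" "c = u * (- Q) + v * (- q\<^sub>2)"
    by blast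
  note abc = this
  have "tangent_field a b c = fun_scale u \<theta>\<^sub>1 + fun_scale v \<theta>\<^sub>2"
    unfolding abc
    by (simp add: fun_eq_iff fun_scale_def \<theta>\<^sub>1_def \<theta>\<^sub>2_def tangent_field_def vector_field_def algebra_simps)
  then have combination: "\<theta> = fun_scale s euler_field + (fun_scale u \<theta>\<^sub>1 + fun_scale v \<theta>\<^sub>2)"
    using \<theta>_eq by simp
  show ?thesis
    unfolding combination
    by (intro fun_module.span_add fun_module.span_scale fun_module.span_base) simp_all
qed

lemma free_log_derivations: "free_submodule (log_derivations F)"
  unfolding free_submodule_def
proof (intro exI[of _ "{euler_field, \<theta>\<^sub>1, \<theta>\<^sub>2}"] conjI)
  show B: "{euler_field, \<theta>\<^sub>1, \<theta>\<^sub>2} \<subseteq> log_derivations F"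
    using basis_in_log_derivations by blast
  show "fun_module.independent {euler_field, \<theta>\<^sub>1, \<theta>\<^sub>2}"
    by (rule independent_basis)
  show "fun_module.span {euler_field, \<theta>\<^sub>1, \<theta>\<^sub>2} = log_derivations F"
    using fun_module.span_minimal[OF B subspace_log_derivations] log_derivation_in_span by blast
qed

section \<open>Squarefreeness\<close>

text \<open>A polynomial whose square divides \<open>F\<close> cannot involve \<open>z\<close>, since \<open>F\<close> has degree one in \<open>z\<close>.
  So it divides both the
  leading coefficient \<open>y\<^bsup>n+4\<^esup>\<close> and the constant coefficient \<open>N\<close>, which is not divisible by the
  prime \<open>y\<close>.\<close>

lemma squarefree_F: "squarefree F"
proof (rule squarefreeI)
  fix p assume p2: "p ^ 2 dvd F"
  define N where "N = [:monom a\<^sub>1 (n + 5):] + [:0, 1:] ^ (n + 3) *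
    ([:monom a\<^sub>2 2:] + [:0, 1:] * [:monom a\<^sub>3 1:] + [:0, 1:] ^ 2 * [:[:a\<^sub>4:]:])"
  have X_power: "x ^ m = [:[:monom 1 m:]:]" for m
    by (simp add: varX_def monom_altdef poly_const_pow)
  have Y_power: "y ^ m = [:[:0, 1:] ^ m:]" for m
    by (simp add: varY_def poly_const_pow)
  have F_eq: "F = [:N, [:0, 1:] ^ (n + 4):]"
    unfolding F_def N_def X_power Y_power
    by (simp add: varX_def varZ_def const3_def power_add algebra_simps eval_nat_numeral
        smult_monom monom_Suc monom_0)
  have "F \<noteq> 0" by (rule F_nonzero)
  then have "degree (p ^ 2) \<le> degree F"
    using p2 by (intro dvd_imp_degree_le) auto
  moreover have "p \<noteq> 0" using p2 \<open>F \<noteq> 0\<close> by auto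
  ultimately have "degree p = 0"
    by (simp add: degree_power_eq F_eq split: if_splits)
  then obtain c where c: "p = [:c:]"
    by (rule degree_eq_zeroE)
  have "p dvd F"
    using p2 by (metis dvd_trans dvd_triv_left power2_eq_square)
  then have "c dvd N" "c dvd [:0, 1:] ^ (n + 4)"
    by (simp_all add: c F_eq const_poly_dvd_iff) (metis coeff_pCons_0 coeff_pCons_Suc)+
  have not_dvd: "\<not> [:0, 1:] dvd c"
  proof
    assume "[:0, 1:] dvd c"
    then have "[:0, 1:] dvd N" using \<open>c dvd N\<close> by (rule dvd_trans)
    then have "coeff N 0 = 0"
      by (simp add: kernel_generated_by_dvd_iff[OF kernel_coeff_0])
    then show False
      using a\<^sub>1 by (simp add: N_def coeff_mult coeff_0_power zero_power)
  qed
  have prime: "prime_elem ([:0, 1:] :: 'k poly poly)"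
    by (rule prime_elem_kernel_generator[OF kernel_coeff_0]) simp
  obtain e where e: "[:0, 1:] ^ (n + 4) = c * e"
    using \<open>c dvd [:0, 1:] ^ (n + 4)\<close> by (elim dvdE)
  have "[:0, 1:] ^ (n + 4) dvd e"
    by (rule prime_power_dvd_multD[OF prime, of _ c]) (simp_all add: not_dvd flip: e)
  then obtain g where "e = [:0, 1:] ^ (n + 4) * g" by (elim dvdE)
  with e have "[:0, 1:] ^ (n + 4) * (c * g) = [:0, 1:] ^ (n + 4) * 1"
    by (simp add: algebra_simps)
  then have "c * g = 1"
    by (subst (asm) mult_cancel_left) simp
  then have "1 = p * [:g:]"
    by (simp add: c one_pCons mult.commute)
  then show "p dvd 1" by (rule dvdI)
qed

end

section \<open>Irreducibility of the zero locus\<close>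

lemma comm_hom_eval3: "comm_hom (\<lambda>p. eval3 p u)"
  by (cases u) (unfold_locales, simp_all)

lemma eval3_simps [simp]:
  "eval3 varX (a, b, c) = a" "eval3 varY (a, b, c) = b" "eval3 varZ (a, b, c) = c"
  "eval3 (const3 k) (a, b, c) = k"
  by (simp_all add: varX_def varY_def varZ_def const3_def)

lemma bivariate_poly_zero:
  fixes G :: "'k::field_char_0 poly poly"
  assumes "\<And>s t. poly (poly G [:t:]) s = 0"
  shows "G = 0"
proof (rule ccontr)
  assume "G \<noteq> 0"
  then have "finite {q. poly G q = 0}" by (rule poly_roots_finite)
  moreover have "poly G [:t:] = 0" for t
    using assms by (simp flip: poly_all_0_iff_0)
  then have "range (\<lambda>t. [:t:]) \<subseteq> {q. poly G q = 0}" by blast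
  ultimately have "finite (range (\<lambda>t :: 'k. [:t:]))"
    by (rule rev_finite_subset)
  then have "finite (UNIV :: 'k set)"
    by (rule finite_imageD) (simp add: inj_def)
  then show False by (simp add: infinite_UNIV_char_0)
qed

text \<open>Pulling back along the parametrization lands in the integral domain \<open>K[s, t]\<close>. If neither of
  two closed sets covers \<open>V\<close>, there are equations of them that do not vanish identically on \<open>V\<close>;
  their pull-backs are non-zero, but the product of the pull-backs vanishes everywhere if the two
  sets together cover \<open>V\<close>.\<close>

lemma irreducible_if_parametrized:
  fixes V :: "('k::field_char_0 \<times> 'k \<times> 'k) set"
    and gx gy gz :: "'k poly poly"
  defines "\<phi> \<equiv> (\<lambda>s t. (poly (poly gx [:t:]) s, poly (poly gy [:t:]) s, poly (poly gz [:t:]) s))"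
  assumes closed: "zariski_closed V"
    and param: "V = {\<phi> s t | s t. True}"
  shows "irreducible_algebraic_set V"
  unfolding irreducible_algebraic_set_def
proof (intro conjI allI impI)
  show "zariski_closed V" by fact
  show "V \<noteq> {}" unfolding param by blast
next
  fix A B assume "zariski_closed A" "zariski_closed B" and V: "V = A \<union> B"
  then obtain P P' where A: "A = zero_locus P" and B: "B = zero_locus P'"
    by (auto simp: zariski_closed_def)
  \<comment> \<open>Composition with the parametrization, as a ring homomorphism \<open>K[x, y, z] \<rightarrow> K[s, t]\<close>.\<close>
  define pull where "pull = subst3 (\<lambda>c. [:[:c:]:]) gx gy gz"
  have hom_const: "comm_hom (\<lambda>c :: 'k. [:[:c:]:])"
    by (rule comm_hom_compose[OF comm_hom_const comm_hom_const])
  interpret pull: comm_hom pull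
    unfolding pull_def by (rule comm_hom_subst3[OF hom_const])
  have eval_pull: "poly (poly (pull p) [:t:]) s = eval3 p (\<phi> s t)" for p s t
  proof (rule comm_hom_poly3_unique)
    show "comm_hom (\<lambda>p. poly (poly (pull p) [:t:]) s)"
      by (intro comm_hom_compose[OF comm_hom_poly] pull.comm_hom_axioms)
    show "comm_hom (\<lambda>p. eval3 p (\<phi> s t))"
      by (rule comm_hom_eval3)
  qed (simp_all add: pull_def subst3_simps[OF hom_const] \<phi>_def del: eval3.simps)
  have point: "\<phi> s t \<in> A \<or> \<phi> s t \<in> B" for s t
    using V param by blast
  show "V = A \<or> V = B"
  proof (rule ccontr)
    assume "\<not> (V = A \<or> V = B)"
    then have "\<exists>u\<in>V. u \<notin> A" "\<exists>u\<in>V. u \<notin> B"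
      using V by blast+
    then obtain s t s' t' where "\<phi> s t \<notin> A" "\<phi> s' t' \<notin> B"
      unfolding param by blast
    then obtain p p' where p: "p \<in> P" "eval3 p (\<phi> s t) \<noteq> 0" and p': "p' \<in> P'" "eval3 p' (\<phi> s' t') \<noteq> 0"
      unfolding A B zero_locus_def by blast
    have "poly (poly (pull p * pull p') [:t:]) s = 0" for s t
      using point[of s t] p(1) p'(1) unfolding A B zero_locus_def
      by (auto simp: eval_pull simp del: eval3.simps)
    then have "pull p * pull p' = 0"
      by (rule bivariate_poly_zero)
    then show False
      using p(2) p'(2) by (auto simp: eval_pull[symmetric] simp del: eval3.simps)
  qed
qed

context rational_curve
begin

lemma eval3_F: "eval3 F (a, b, c) = b ^ (n + 4) * (c + a\<^sub>3 * a + a\<^sub>4 * b)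
    + a\<^sub>1 * a ^ (n + 5) + a\<^sub>2 * a ^ 2 * b ^ (n + 3)"
proof -
  interpret ev: comm_hom "\<lambda>p :: 'k poly3. eval3 p (a, b, c)" by (rule comm_hom_eval3)
  show ?thesis
    by (simp add: F_def power_add algebra_simps eval_nat_numeral del: eval3.simps)
qed

text \<open>The projective curve is rational: in the chart \<open>y = 1\<close> it is the graph
  \<open>w = - (a\<^sub>1 s\<^bsup>d\<^esup> + a\<^sub>2 s\<^sup>2)\<close>. Homogenizing with \<open>t\<close> gives a map from the plane to the cone over
  it, which is onto since \<open>d\<close>-th roots in \<open>K\<close> take care of the scaling of the cone. The points with
  \<open>y = 0\<close> form the line \<open>x = y = 0\<close>, the image of \<open>t = 0\<close>.\<close>

lemma zero_locus_F_parametrized: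
  "zero_locus {F} = {(s * t ^ (n + 4), t ^ (n + 5),
     - (a\<^sub>1 * s ^ (n + 5) + a\<^sub>2 * s ^ 2 * t ^ (n + 3)) - a\<^sub>3 * (s * t ^ (n + 4)) - a\<^sub>4 * t ^ (n + 5)) | s t. True}"
    (is "_ = ?W")
proof (intro equalityI subsetI)
  fix u assume "u \<in> ?W"
  then obtain s t where u: "u = (s * t ^ (n + 4), t ^ (n + 5),
     - (a\<^sub>1 * s ^ (n + 5) + a\<^sub>2 * s ^ 2 * t ^ (n + 3)) - a\<^sub>3 * (s * t ^ (n + 4)) - a\<^sub>4 * t ^ (n + 5))"
    by blast
  have "(t ^ (n + 5)) ^ (n + 4) = (t ^ (n + 4)) ^ (n + 5)"
    by (simp only: power_mult[symmetric] mult.commute)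
  moreover have "(t ^ (n + 4)) ^ 2 * (t ^ (n + 5)) ^ (n + 3) = (t ^ (n + 4)) ^ (n + 5) * t ^ (n + 3)"
    by (simp only: power_mult[symmetric] power_add[symmetric]) (simp add: algebra_simps)
  ultimately show "u \<in> zero_locus {F}"
    unfolding u zero_locus_def
    by (simp add: eval3_F power_mult_distrib algebra_simps del: eval3.simps)
next
  fix u assume "u \<in> zero_locus {F}"
  moreover obtain a b c where u: "u = (a, b, c)" by (cases u)
  ultimately have eq: "b ^ (n + 4) * (c + a\<^sub>3 * a + a\<^sub>4 * b)
    + a\<^sub>1 * a ^ (n + 5) + a\<^sub>2 * a ^ 2 * b ^ (n + 3) = 0"
    by (simp add: zero_locus_def eval3_F del: eval3.simps)
  show "u \<in> ?W"
  proof (cases "b = 0")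
    case True
    with eq a\<^sub>1 have "a = 0" by (simp add: zero_power)
    moreover obtain s where "s ^ (n + 5) = - c / a\<^sub>1"
      using nth_root_exists[of "n + 5"] by auto
    ultimately have "u = (s * 0 ^ (n + 4), 0 ^ (n + 5),
     - (a\<^sub>1 * s ^ (n + 5) + a\<^sub>2 * s ^ 2 * 0 ^ (n + 3)) - a\<^sub>3 * (s * 0 ^ (n + 4)) - a\<^sub>4 * 0 ^ (n + 5))"
      using True a\<^sub>1 by (simp add: u zero_power)
    then show ?thesis by blast
  next
    case False
    obtain t where t: "t ^ (n + 5) = b"
      using nth_root_exists[of "n + 5"] by auto
    with False have "t \<noteq> 0" by (auto simp: zero_power)
    define s where "s = a / t ^ (n + 4)"
    have a: "a = s * t ^ (n + 4)"
      using \<open>t \<noteq> 0\<close> by (simp add: s_def)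
    have "(t ^ (n + 5)) ^ (n + 4) = (t ^ (n + 4)) ^ (n + 5)"
      by (simp only: power_mult[symmetric] mult.commute)
    moreover have "(t ^ (n + 4)) ^ 2 * (t ^ (n + 5)) ^ (n + 3) = (t ^ (n + 4)) ^ (n + 5) * t ^ (n + 3)"
      by (simp only: power_mult[symmetric] power_add[symmetric]) (simp add: algebra_simps)
    ultimately have "b ^ (n + 4) * (c + a\<^sub>3 * a + a\<^sub>4 * b + a\<^sub>1 * s ^ (n + 5) + a\<^sub>2 * s ^ 2 * t ^ (n + 3)) = 0"
      using eq unfolding a t[symmetric] by (simp add: power_mult_distrib algebra_simps)
    then have "c + a\<^sub>3 * a + a\<^sub>4 * b + a\<^sub>1 * s ^ (n + 5) + a\<^sub>2 * s ^ 2 * t ^ (n + 3) = 0"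
      unfolding mult_eq_0_iff using False by auto
    then have "c = - (a\<^sub>1 * s ^ (n + 5) + a\<^sub>2 * s ^ 2 * t ^ (n + 3)) - a\<^sub>3 * a - a\<^sub>4 * b"
      by (simp add: eq_neg_iff_add_eq_0 algebra_simps)
    then show ?thesis
      unfolding u using a t by blast
  qed
qed

lemma irreducible_zero_locus_F: "irreducible_algebraic_set (zero_locus {F})"
proof -
  let ?s = "[:[:0, 1:]:] :: 'k poly poly" and ?t = "[:0, 1:] :: 'k poly poly"
  let ?c = "\<lambda>c :: 'k. [:[:c:]:]"
  let ?gz = "- (?c a\<^sub>1 * ?s ^ (n + 5) + ?c a\<^sub>2 * ?s ^ 2 * ?t ^ (n + 3))
    - ?c a\<^sub>3 * (?s * ?t ^ (n + 4)) - ?c a\<^sub>4 * ?t ^ (n + 5)"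
  show ?thesis
  proof (rule irreducible_if_parametrized)
    show "zariski_closed (zero_locus {F})"
      unfolding zariski_closed_def by blast
    show "zero_locus {F} = {(poly (poly (?s * ?t ^ (n + 4)) [:t:]) s,
      poly (poly (?t ^ (n + 5)) [:t:]) s, poly (poly ?gz [:t:]) s) | s t. True}"
      unfolding zero_locus_F_parametrized by (simp add: algebra_simps)
  qed
qed

lemma free_divisor_F: "free_divisor F"
  by (simp add: free_divisor_def squarefree_F free_log_derivations)

end

section \<open>Kernels of maps to Rees algebras\<close>

lemma coeff_subst_monom:
  "coeff (subst_poly (\<lambda>r. [:r:]) (monom f 1) p) i = coeff p i * f ^ i"
proof (induction p arbitrary: i)
  case 0
  show ?case by simp
next
  case (pCons c p)
  have "subst_poly (\<lambda>r. [:r:]) (monom f 1) (pCons c p)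
      = pCons c (smult f (subst_poly (\<lambda>r. [:r:]) (monom f 1) p))"
    by (simp add: subst_poly_pCons comm_hom_const monom_Suc monom_0)
  then show ?case
    using pCons.IH by (simp add: coeff_pCons split: nat.splits)
qed

text \<open>The relations \<open>f\<^sub>3 T\<^sub>i - f\<^sub>i T\<^sub>3\<close> turn \<open>T\<^sub>1\<close> and \<open>T\<^sub>2\<close> into multiples of \<open>T\<^sub>3\<close> at the cost of a
  factor \<open>f\<^sub>3\<close>. So a power of \<open>f\<^sub>3\<close> moves any \<open>g\<close> into \<open>R[T\<^sub>3]\<close> modulo \<open>A\<close>. There the map
  \<open>T\<^sub>3 \<mapsto> f\<^sub>3 t\<close> is injective, so an element of the kernel satisfies \<open>f\<^sub>3\<^bsup>N\<^esup> g \<in> A\<close>, and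
  \<open>f\<^sub>3\<close> can be cancelled modulo \<open>A\<close>.\<close>

lemma kernel_rees_map_in_ideal:
  fixes f\<^sub>1 f\<^sub>2 f\<^sub>3 :: "'r::idom" and A :: "'r poly3 set"
  assumes "f\<^sub>3 \<noteq> 0"
    and zero: "0 \<in> A" and add: "\<And>p q. p \<in> A \<Longrightarrow> q \<in> A \<Longrightarrow> p + q \<in> A" and mult: "\<And>p q. q \<in> A \<Longrightarrow> p * q \<in> A"
    and kernel: "\<And>p. p \<in> A \<Longrightarrow> rees_map f\<^sub>1 f\<^sub>2 f\<^sub>3 p = 0"
    and koszul: "linear_form f\<^sub>3 0 (- f\<^sub>1) \<in> A" "linear_form 0 f\<^sub>3 (- f\<^sub>2) \<in> A"
    and cancel: "\<And>p. const3 f\<^sub>3 * p \<in> A \<Longrightarrow> p \<in> A"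
    and g: "rees_map f\<^sub>1 f\<^sub>2 f\<^sub>3 g = 0"
  shows "g \<in> A"
proof -
  interpret const3: comm_hom "const3 :: 'r \<Rightarrow> 'r poly3" by (rule comm_hom_const3)
  interpret rees: comm_hom "rees_map f\<^sub>1 f\<^sub>2 f\<^sub>3"
    unfolding rees_map_def by (rule comm_hom_subst3[OF comm_hom_const])
  let ?C = "const3 f\<^sub>3"
  have "\<exists>N r. ?C ^ N * p - [:[:r:]:] \<in> A" for p
  proof (induction p rule: poly3_induct)
    case (const c)
    show ?case
      by (intro exI[of _ 0] exI[of _ "[:c:]"]) (simp add: const3_def zero)
  next
    case (add p q)
    then obtain M r N s where *: "?C ^ M * p - [:[:r:]:] \<in> A" "?C ^ N * q - [:[:s:]:] \<in> A"
      by blast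
    have C: "?C ^ K * [:[:r:]:] = [:[:[:f\<^sub>3:] ^ K * r:]:]" for K and r :: "'r poly"
      by (simp add: const3_def poly_const_pow)
    have "?C ^ (M + N) * (p + q) - [:[:[:f\<^sub>3:] ^ N * r + [:f\<^sub>3:] ^ M * s:]:]
        = ?C ^ (M + N) * (p + q) - (?C ^ N * [:[:r:]:] + ?C ^ M * [:[:s:]:])"
      unfolding C by simp
    also have "\<dots> = ?C ^ N * (?C ^ M * p - [:[:r:]:]) + ?C ^ M * (?C ^ N * q - [:[:s:]:])"
      by (simp only: power_add) (simp only: algebra_simps)
    also have "\<dots> \<in> A"
      by (intro assms(3) mult *)
    finally show ?case by blast
  next
    case (varX p)
    then obtain N r where *: "?C ^ N * p - [:[:r:]:] \<in> A" by blast
    have "?C ^ N * (T\<^sub>3 * p) - [:[:[:0, 1:] * r:]:] = T\<^sub>3 * (?C ^ N * p) - T\<^sub>3 * [:[:r:]:]"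
      by (simp only: mult.left_commute) (simp add: varX_def)
    also have "\<dots> = T\<^sub>3 * (?C ^ N * p - [:[:r:]:])"
      by (simp only: right_diff_distrib)
    finally show ?case
      using mult[OF *] by metis
  next
    have step: "\<exists>N r. ?C ^ N * (T * p) - [:[:r:]:] \<in> A"
      if T: "?C * T - const3 f * T\<^sub>3 \<in> A" and p: "\<exists>N r. ?C ^ N * p - [:[:r:]:] \<in> A" for T f p
    proof -
      from p obtain N r where *: "?C ^ N * p - [:[:r:]:] \<in> A" by blast
      have "?C ^ Suc N * (T * p) - [:[:[:f:] * ([:0, 1:] * r):]:]
          = ?C ^ Suc N * (T * p) - const3 f * (T\<^sub>3 * [:[:r:]:])"
        by (simp add: varX_def const3_def)
      also have "\<dots> = (?C * T) * (?C ^ N * p - [:[:r:]:]) + [:[:r:]:] * (?C * T - const3 f * T\<^sub>3)"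
        by (simp only: power_Suc algebra_simps)
      also have "\<dots> \<in> A"
        by (intro add mult * T)
      finally show ?thesis by blast
    qed
    {
      case (varY p)
      then show ?case
        using koszul(2) by (intro step) (simp_all add: linear_form_def)
    next
      case (varZ p)
      then show ?case
        using koszul(1) by (intro step) (simp_all add: linear_form_def)
    }
  qed
  then obtain N r where r: "?C ^ N * g - [:[:r:]:] \<in> A" by blast
  have "rees_map f\<^sub>1 f\<^sub>2 f\<^sub>3 [:[:r:]:] = subst_poly (\<lambda>r. [:r:]) (monom f\<^sub>3 1) r"
    by (simp add: rees_map_def subst3_def subst_poly_pCons comm_hom_subst_poly comm_hom_const)
  then have "subst_poly (\<lambda>r. [:r:]) (monom f\<^sub>3 1) r = 0"
    using kernel[OF r] g by simp
  then have "coeff r i * f\<^sub>3 ^ i = 0" for i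
    using coeff_subst_monom[of f\<^sub>3 r i] by simp
  then have "r = 0"
    using \<open>f\<^sub>3 \<noteq> 0\<close> by (simp add: poly_eq_iff)
  with r have "?C ^ N * g \<in> A" by simp
  then show ?thesis
    by (induction N) (auto simp: mult.assoc intro: cancel)
qed

section \<open>Cancellation modulo two relations\<close>

text \<open>Modulo \<open>y\<close> the equation says \<open>c x\<^sup>2 t p + m q = 0\<close>. As \<open>m\<close> is non-zero modulo the prime ideals
  \<open>(y, x)\<close> and \<open>(y, t)\<close>, the factors \<open>x\<close>, \<open>x\<close> and \<open>t\<close> can be split off from \<open>q\<close> one after
  the other. Hence \<open>(p, q)\<close> is, modulo \<open>y\<close>, a multiple of the Koszul syzygy \<open>(l\<^sub>2, - l\<^sub>1)\<close>; subtracting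
  this multiple does not change \<open>p l\<^sub>1 + q l\<^sub>2\<close> and leaves coefficients divisible by \<open>y\<close>.\<close>

lemma torsion_free_mod_two_relations:
  fixes y x t m u v c c' g p q :: "'s::idom"
    and hy :: "'s \<Rightarrow> 'a::idom" and hxy :: "'s \<Rightarrow> 'b::idom" and hty :: "'s \<Rightarrow> 'c::idom"
  defines "l\<^sub>1 \<equiv> y * u - c * x ^ 2 * t" and "l\<^sub>2 \<equiv> y * v - m"
  assumes ker: "kernel_generated_by hy y 0" "kernel_generated_by hxy y x" "kernel_generated_by hty y t"
    and nonzero: "hy x \<noteq> 0" "hy t \<noteq> 0" "hxy m \<noteq> 0" "hty m \<noteq> 0" "y \<noteq> 0"
    and unit: "c * c' = 1"
    and eq: "y * g = p * l\<^sub>1 + q * l\<^sub>2"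
  shows "\<exists>p' q'. g = p' * l\<^sub>1 + q' * l\<^sub>2"
proof -
  interpret hy: comm_hom hy using ker(1) unfolding kernel_generated_by_def by blast
  interpret hxy: comm_hom hxy using ker(2) unfolding kernel_generated_by_def by blast
  interpret hty: comm_hom hty using ker(3) unfolding kernel_generated_by_def by blast
  have [simp]: "hy y = 0" "hxy y = 0" "hxy x = 0" "hty y = 0" "hty t = 0"
    using ker unfolding kernel_generated_by_def by blast+
  have hy_dvd: "\<exists>r. a = y * r" if "hy a = 0" for a
    using ker(1) that unfolding kernel_generated_by_def
    by (metis add.right_neutral mult_zero_left)
  have *: "c * x ^ 2 * t * p + m * q = y * (u * p + v * q - g)"
    using eq by (simp add: l\<^sub>1_def l\<^sub>2_def algebra_simps)
  have "hxy (c * x ^ 2 * t * p + m * q) = 0"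
    unfolding * by simp
  then have "hxy q = 0"
    using nonzero by simp
  then obtain q\<^sub>1 q\<^sub>2 where q: "q = y * q\<^sub>1 + x * q\<^sub>2"
    using ker(2) unfolding kernel_generated_by_def by blast
  have "hy (c * x ^ 2 * t * p + m * q) = 0"
    unfolding * by simp
  then have "hy x * hy (c * x * t * p + m * q\<^sub>2) = 0"
    by (simp add: q power2_eq_square algebra_simps)
  then have **: "hy (c * x * t * p + m * q\<^sub>2) = 0"
    using nonzero by simp
  then obtain r where r: "c * x * t * p + m * q\<^sub>2 = y * r"
    using hy_dvd[OF **] by blast
  have "hxy (c * x * t * p + m * q\<^sub>2) = 0"
    unfolding r by simp
  then have "hxy q\<^sub>2 = 0"
    using nonzero by simp
  then obtain q\<^sub>3 q\<^sub>4 where q\<^sub>2: "q\<^sub>2 = y * q\<^sub>3 + x * q\<^sub>4"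
    using ker(2) unfolding kernel_generated_by_def by blast
  from ** have "hy x * hy (c * t * p + m * q\<^sub>4) = 0"
    by (simp add: q\<^sub>2 algebra_simps)
  then have **: "hy (c * t * p + m * q\<^sub>4) = 0"
    using nonzero by simp
  then obtain r' where r': "c * t * p + m * q\<^sub>4 = y * r'"
    using hy_dvd[OF **] by blast
  have "hty (c * t * p + m * q\<^sub>4) = 0"
    unfolding r' by simp
  then have "hty q\<^sub>4 = 0"
    using nonzero by simp
  then obtain q\<^sub>5 q\<^sub>6 where q\<^sub>4: "q\<^sub>4 = y * q\<^sub>5 + t * q\<^sub>6"
    using ker(3) unfolding kernel_generated_by_def by blast
  from ** have "hy t * hy (c * p + m * q\<^sub>6) = 0"
    by (simp add: q\<^sub>4 algebra_simps)
  then have "hy (c * p + m * q\<^sub>6) = 0"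
    using nonzero by simp
  from hy_dvd[OF this] obtain s where s: "c * p + m * q\<^sub>6 = y * s"
    by blast

  \<comment> \<open>The multiple of the Koszul syzygy \<open>(l\<^sub>2, - l\<^sub>1)\<close> to be subtracted from \<open>(p, q)\<close>.\<close>
  define w where "w = c' * q\<^sub>6"
  have p_eq: "p = y * (c' * s - w * v) + w * l\<^sub>2"
  proof -
    have "p = c' * (c * p + m * q\<^sub>6) - c' * m * q\<^sub>6"
      using unit by (simp add: algebra_simps)
    also have "\<dots> = y * (c' * s - w * v) + w * l\<^sub>2"
      unfolding s by (simp add: w_def l\<^sub>2_def algebra_simps)
    finally show ?thesis .
  qed
  have q_eq: "q = y * (q\<^sub>1 + x * q\<^sub>3 + x ^ 2 * q\<^sub>5 + w * u) - w * l\<^sub>1"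
  proof -
    have "w * (c * x ^ 2 * t) = (c * c') * (q\<^sub>6 * x ^ 2 * t)"
      by (simp add: w_def algebra_simps)
    then have "q\<^sub>6 * x ^ 2 * t = w * (c * x ^ 2 * t)"
      unfolding unit mult_1_left by (rule sym)
    then show ?thesis
      by (simp add: q q\<^sub>2 q\<^sub>4 l\<^sub>1_def power2_eq_square algebra_simps)
  qed
  have "y * g = y * ((c' * s - w * v) * l\<^sub>1 + (q\<^sub>1 + x * q\<^sub>3 + x ^ 2 * q\<^sub>5 + w * u) * l\<^sub>2)"
    unfolding eq by (subst p_eq, subst q_eq) (simp add: algebra_simps)
  then have "g = (c' * s - w * v) * l\<^sub>1 + (q\<^sub>1 + x * q\<^sub>3 + x ^ 2 * q\<^sub>5 + w * u) * l\<^sub>2"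
    using nonzero by simp
  then show ?thesis by blast
qed

lemma kernel_coeff_00:
  "kernel_generated_by (\<lambda>c. coeff (coeff c 0) 0) [:0, 1:] [:[:0, 1:] :: 'a::comm_ring_1 poly:]"
proof -
  have "\<exists>a b. c = [:0, 1:] * a + [:[:0, 1:]:] * b" if "coeff (coeff c 0) 0 = 0" for c :: "'a poly poly"
  proof -
    obtain c\<^sub>0 c\<^sub>1 where c: "c = pCons c\<^sub>0 c\<^sub>1" by (cases c)
    have "coeff c\<^sub>0 0 = 0"
      using that c by simp
    then obtain c\<^sub>2 where "c\<^sub>0 = pCons 0 c\<^sub>2"
      by (cases c\<^sub>0) auto
    with c have "c = [:0, 1:] * c\<^sub>1 + [:[:0, 1:]:] * [:c\<^sub>2:]"
      by simp
    then show ?thesis by blast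
  qed
  then show ?thesis
    by (auto simp: kernel_generated_by_def comm_hom_coeff_0 comm_hom_compose[OF comm_hom_coeff_0])
qed

definition mod_varXY :: "'k::comm_ring_1 poly3 \<Rightarrow> 'k poly" where
  "mod_varXY = map_poly (\<lambda>c. coeff (coeff c 0) 0)"

lemma kernel_mod_varXY: "kernel_generated_by mod_varXY varY (varX :: 'k::comm_ring_1 poly3)"
  using kernel_generated_by_map_poly[OF kernel_coeff_00] by (simp add: mod_varXY_def varX_def varY_def)

lemma mod_varXY_simps [simp]:
  "mod_varXY varX = 0" "mod_varXY varY = 0" "mod_varXY varZ = [:0, 1:]" "mod_varXY (const3 c) = [:c:]"
  by (simp_all add: mod_varXY_def varX_def varY_def varZ_def const3_def map_poly_pCons)

lemma kernel_map_poly3: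
  assumes "kernel_generated_by h x y"
  shows "kernel_generated_by (map_poly (map_poly (map_poly h))) (const3 x) (const3 y)"
  unfolding const3_def by (intro kernel_generated_by_map_poly assms)

lemma map_poly3_simps:
  assumes "comm_hom h"
  shows "map_poly (map_poly (map_poly h)) (const3 c) = const3 (h c)"
    "map_poly (map_poly (map_poly h)) varX = varX" "map_poly (map_poly (map_poly h)) varY = varY"
    "map_poly (map_poly (map_poly h)) varZ = varZ"
proof -
  interpret comm_hom h by fact
  show "map_poly (map_poly (map_poly h)) (const3 c) = const3 (h c)"
    "map_poly (map_poly (map_poly h)) varX = varX" "map_poly (map_poly (map_poly h)) varY = varY"
    "map_poly (map_poly (map_poly h)) varZ = varZ"
    by (simp_all add: const3_def varX_def varY_def varZ_def map_poly_pCons one_pCons)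
qed

text \<open>With \<open>h\<close> the reduction modulo \<open>y\<close> this is the reduction modulo \<open>(y, T\<^sub>3)\<close>.\<close>

lemma kernel_mod_and_coeff_0:
  fixes h :: "'a::comm_ring_1 \<Rightarrow> 'b::comm_ring_1"
  assumes h: "kernel_generated_by h x 0"
  shows "kernel_generated_by (map_poly (map_poly (\<lambda>c. h (coeff c 0)))) (const3 x) varX"
proof -
  have "\<exists>a b. c = [:x:] * a + [:0, 1:] * b" if c0: "h (coeff c 0) = 0" for c
  proof -
    obtain c\<^sub>0 c\<^sub>1 where c: "c = pCons c\<^sub>0 c\<^sub>1" by (cases c)
    moreover obtain c\<^sub>2 where "c\<^sub>0 = x * c\<^sub>2"
      using h c0 c unfolding kernel_generated_by_def by auto
    ultimately have "c = [:x:] * [:c\<^sub>2:] + [:0, 1:] * c\<^sub>1"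
      by simp
    then show ?thesis by blast
  qed
  moreover have hom: "comm_hom h"
    using h unfolding kernel_generated_by_def by blast
  moreover have "h 0 = 0" "h x = 0"
    using comm_hom.zero[OF hom] h unfolding kernel_generated_by_def by auto
  ultimately have "kernel_generated_by (\<lambda>c. h (coeff c 0)) [:x:] [:0, 1:]"
    by (auto simp: kernel_generated_by_def comm_hom_compose[OF hom comm_hom_coeff_0])
  then show ?thesis
    unfolding const3_def varX_def by (intro kernel_generated_by_map_poly)
qed

section \<open>Linear type in degree five\<close>

context rational_curve
begin

interpretation const3: comm_hom "const3 :: 'k \<Rightarrow> 'k poly3"
  by (rule comm_hom_const3)
interpretation S_const: comm_hom "const3 :: 'k poly3 \<Rightarrow> 'k poly3 poly3"
  by (rule comm_hom_const3)

definition "L\<^sub>1 = linear_form 0 (y ^ 2) (- Q)"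
definition "L\<^sub>2 = linear_form (y ^ (n + 2)) (- p\<^sub>2) (- q\<^sub>2)"

lemma linear_type_gradient_ideal_iff:
  "linear_type (gradient_ideal F) \<longleftrightarrow>
    (\<forall>g. rees_map f\<^sub>1 f\<^sub>2 f\<^sub>3 g = 0 \<longrightarrow> (\<exists>u v. g = u * L\<^sub>1 + v * L\<^sub>2))"
  unfolding gradient_ideal_F L\<^sub>1_def L\<^sub>2_def
  using syzygy\<^sub>1 syzygy\<^sub>2 syzygies_generated by (rule linear_type_iff_presentation)

interpretation rees: comm_hom "rees_map f\<^sub>1 f\<^sub>2 f\<^sub>3"
  unfolding rees_map_def by (rule comm_hom_subst3[OF comm_hom_const])

lemma rees_map_linear_form:
  "rees_map f\<^sub>1 f\<^sub>2 f\<^sub>3 (linear_form a b c) = monom (a * f\<^sub>1 + b * f\<^sub>2 + c * f\<^sub>3) 1"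
  by (simp add: linear_form_def)
    (simp add: rees_map_def subst3_simps comm_hom_const smult_monom add_monom)

lemma rees_map_L [simp]: "rees_map f\<^sub>1 f\<^sub>2 f\<^sub>3 L\<^sub>1 = 0" "rees_map f\<^sub>1 f\<^sub>2 f\<^sub>3 L\<^sub>2 = 0"
  by (simp_all only: L\<^sub>1_def L\<^sub>2_def rees_map_linear_form syzygy\<^sub>1 syzygy\<^sub>2 monom_eq_0_iff)

lemma syzygy_in_L:
  assumes "a * f\<^sub>1 + b * f\<^sub>2 + c * f\<^sub>3 = 0"
  shows "\<exists>u v. linear_form a b c = u * L\<^sub>1 + v * L\<^sub>2"
proof -
  from syzygies_generated[OF assms] obtain u v
    where abc: "a = u * 0 + v * y ^ (n + 2)" "b = u * y ^ 2 + v * (- p\<^sub>2)" "c = u * (- Q) + v * (- q\<^sub>2)"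
    by blast
  have "linear_form a b c = const3 u * L\<^sub>1 + const3 v * L\<^sub>2"
    unfolding abc by (simp add: linear_form_def L\<^sub>1_def L\<^sub>2_def algebra_simps)
  then show ?thesis by blast
qed

lemma L\<^sub>1_eq: "L\<^sub>1 = const3 y * (const3 y * T\<^sub>2 - const3 (const3 \<epsilon> * w) * T\<^sub>3)
    - const3 (const3 \<gamma>) * const3 x ^ 2 * T\<^sub>3"
  by (simp add: L\<^sub>1_def linear_form_def Q_def algebra_simps power2_eq_square)

text \<open>For \<open>n = 0\<close> the form \<open>M\<close>, which is \<open>- L\<^sub>2\<close> modulo \<open>y\<close>, contains the term \<open>w\<^sup>2 T\<^sub>3\<close>
  without a factor \<open>x\<close> and the term \<open>x\<^sup>2 T\<^sub>2\<close> without a factor \<open>T\<^sub>3\<close>, so it is prime to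
  \<open>x\<^sup>2 T\<^sub>3\<close>, the form of \<open>L\<^sub>1\<close>.\<close>

lemma y_cancel_mod_L:
  assumes "n = 0" and g: "const3 y * g = p * L\<^sub>1 + q * L\<^sub>2"
  shows "\<exists>p q. g = p * L\<^sub>1 + q * L\<^sub>2"
proof -
  define M where "M = const3 (const3 \<kappa>) *
    (const3 (const3 \<gamma>) * const3 x ^ 2 * T\<^sub>2 + const3 (const3 \<epsilon>) ^ 2 * const3 w ^ 2 * T\<^sub>3)"
  have L\<^sub>2_eq: "L\<^sub>2 = const3 y * (const3 y * T\<^sub>1 + const3 (const3 \<kappa> * const3 \<epsilon> * w) * T\<^sub>2
      - const3 (const3 \<delta> * x) * T\<^sub>3) - M"
    unfolding L\<^sub>2_def linear_form_def p\<^sub>2_def q\<^sub>2_def M_def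
    using \<open>n = 0\<close> by (simp add: algebra_simps power2_eq_square)
  note kernels = kernel_map_poly3[OF kernel_mod_varY] kernel_map_poly3[OF kernel_mod_varXY]
    kernel_mod_and_coeff_0[OF kernel_mod_varY]
  have homs: "comm_hom (mod_varY :: 'k poly3 \<Rightarrow> _)" "comm_hom (mod_varXY :: 'k poly3 \<Rightarrow> _)"
    using kernel_mod_varY kernel_mod_varXY unfolding kernel_generated_by_def by blast+
  interpret mod_varY: comm_hom "mod_varY :: 'k poly3 \<Rightarrow> _" by (rule homs)
  interpret mod_varXY: comm_hom "mod_varXY :: 'k poly3 \<Rightarrow> _" by (rule homs)
  let ?hy = "map_poly (map_poly (map_poly mod_varY)) :: 'k poly3 poly3 \<Rightarrow> _"
  let ?hxy = "map_poly (map_poly (map_poly mod_varXY)) :: 'k poly3 poly3 \<Rightarrow> _"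
  let ?hty = "map_poly (map_poly (\<lambda>c. mod_varY (coeff c 0))) :: 'k poly3 poly3 \<Rightarrow> _"
  interpret hxy: comm_hom ?hxy using kernels(2) unfolding kernel_generated_by_def by blast
  interpret hty: comm_hom ?hty using kernels(3) unfolding kernel_generated_by_def by blast
  have hty: "?hty (const3 c) = [:[:mod_varY c:]:]" "?hty T\<^sub>3 = 0" "?hty T\<^sub>2 = [:[:0, 1:]:]" for c
    by (simp_all add: const3_def varX_def varY_def map_poly_pCons)
  have kernel_hy: "kernel_generated_by ?hy (const3 y) 0"
    using kernel_map_poly3[OF kernel_mod_varY[where 'k = 'k]] by simp
  show ?thesis
    using g unfolding L\<^sub>1_eq L\<^sub>2_eq
  proof (rule torsion_free_mod_two_relations[OF kernel_hy kernels(2) kernels(3), rotated -1])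
    show "?hy (const3 x) \<noteq> 0" "?hy T\<^sub>3 \<noteq> 0"
      by (simp_all add: map_poly3_simps[OF homs(1)]) (simp_all add: const3_def varX_def)
    show "?hxy M \<noteq> 0"
      unfolding M_def
      by (simp add: map_poly3_simps[OF homs(2)] w_def) (simp add: const3_def varX_def)
    show "?hty M \<noteq> 0"
      unfolding M_def by (simp add: hty)
    show "const3 y \<noteq> (0 :: 'k poly3 poly3)"
      by (simp add: const3_def varY_def)
    show "const3 (const3 \<gamma>) * const3 (const3 (1 / \<gamma>)) = (1 :: 'k poly3 poly3)"
      by (simp flip: const3.mult S_const.mult)
  qed
qed

lemma linear_type_if_degree_5:
  assumes "n = 0"
  shows "linear_type (gradient_ideal F)"
  unfolding linear_type_gradient_ideal_iff
proof (intro allI impI)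
  fix g assume g: "rees_map f\<^sub>1 f\<^sub>2 f\<^sub>3 g = 0"
  let ?A = "{u * L\<^sub>1 + v * L\<^sub>2 | u v. True}"
  have "g \<in> ?A"
  proof (rule kernel_rees_map_in_ideal[OF _ _ _ _ _ _ _ _ g])
    show "f\<^sub>3 \<noteq> 0" by (simp add: f\<^sub>3_def varY_def)
    have "0 = 0 * L\<^sub>1 + 0 * L\<^sub>2" by simp
    then show "0 \<in> ?A" by blast
    show "p + q \<in> ?A" if "p \<in> ?A" "q \<in> ?A" for p q
    proof -
      from that obtain u v u' v' where "p = u * L\<^sub>1 + v * L\<^sub>2" "q = u' * L\<^sub>1 + v' * L\<^sub>2" by blast
      then have "p + q = (u + u') * L\<^sub>1 + (v + v') * L\<^sub>2" by (simp add: algebra_simps)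
      then show ?thesis by blast
    qed
    show "r * p \<in> ?A" if "p \<in> ?A" for r p
    proof -
      from that obtain u v where "p = u * L\<^sub>1 + v * L\<^sub>2" by blast
      then have "r * p = (r * u) * L\<^sub>1 + (r * v) * L\<^sub>2" by (simp add: algebra_simps)
      then show ?thesis by blast
    qed
    show "rees_map f\<^sub>1 f\<^sub>2 f\<^sub>3 p = 0" if "p \<in> ?A" for p
    proof -
      from that obtain u v where "p = u * L\<^sub>1 + v * L\<^sub>2" by blast
      then show ?thesis by simp
    qed
    show "linear_form f\<^sub>3 0 (- f\<^sub>1) \<in> ?A"
      using syzygy_in_L[of f\<^sub>3 0 "- f\<^sub>1"] by (simp add: mult.commute)
    show "linear_form 0 f\<^sub>3 (- f\<^sub>2) \<in> ?A"
      using syzygy_in_L[of 0 f\<^sub>3 "- f\<^sub>2"] by (simp add: mult.commute)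
    have cancel: "p \<in> ?A" if "const3 y * p \<in> ?A" for p
      using that y_cancel_mod_L[OF \<open>n = 0\<close>] by blast
    show "p \<in> ?A" if "const3 f\<^sub>3 * p \<in> ?A" for p
    proof -
      have "const3 f\<^sub>3 * p = const3 y * (const3 y * (const3 y * (const3 y * p)))"
        unfolding f\<^sub>3_def using \<open>n = 0\<close> by (simp add: eval_nat_numeral mult.assoc)
      with that have "const3 y * (const3 y * (const3 y * (const3 y * p))) \<in> ?A"
        by (rule subst[of _ _ "\<lambda>r. r \<in> ?A", rotated])
      then show ?thesis
        by (rule cancel[OF cancel[OF cancel[OF cancel]]])
    qed
  qed
  then show "\<exists>u v. g = u * L\<^sub>1 + v * L\<^sub>2" by blast
qed

section \<open>Failure of linear type in higher degree\<close>

text \<open>For \<open>n > 0\<close> all coefficients of \<open>L\<^sub>1\<close> and \<open>L\<^sub>2\<close> lie in \<open>(x, y)\<close>, say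
  \<open>L\<^sub>i = y A\<^sub>i + x B\<^sub>i\<close>. By Cramer's rule \<open>y\<close> times \<open>\<Delta> = A\<^sub>1 B\<^sub>2 - B\<^sub>1 A\<^sub>2\<close> lies in
  \<open>(L\<^sub>1, L\<^sub>2)\<close>, so \<open>\<Delta>\<close> is in the kernel. It is not in \<open>(L\<^sub>1, L\<^sub>2)\<close>: on the curve
  \<open>y = - (\<gamma>/\<epsilon>) x\<^sup>2\<close>, \<open>w = 1\<close> and at \<open>T = (0, 0, 1)\<close> the form \<open>L\<^sub>1\<close> vanishes, \<open>L\<^sub>2\<close> has order \<open>n\<close>
  in the parameter \<open>x\<close>, and \<open>\<Delta>\<close> has order \<open>n - 1\<close>.\<close>

lemma not_linear_type_if_degree_gt_5:
  assumes n: "n = Suc m"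
  shows "\<not> linear_type (gradient_ideal F)"
proof
  assume lt: "linear_type (gradient_ideal F)"
  define A\<^sub>1 where "A\<^sub>1 = const3 y * T\<^sub>2 - const3 (const3 \<epsilon> * w) * T\<^sub>3"
  define B\<^sub>1 where "B\<^sub>1 = - const3 (const3 \<gamma> * x) * T\<^sub>3"
  define A\<^sub>2 where "A\<^sub>2 = const3 (y ^ (m + 2)) * T\<^sub>1 + const3 (const3 (\<kappa> * \<epsilon>) * x ^ Suc m * w) * T\<^sub>2"
  define B\<^sub>2 where "B\<^sub>2 = - const3 (const3 (\<kappa> * \<gamma>) * x ^ (m + 2)) * T\<^sub>2
    - const3 (const3 \<kappa> * const3 \<epsilon> ^ 2 * x ^ m * w ^ 2 + const3 \<delta> * y ^ (m + 2)) * T\<^sub>3"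
  have L: "L\<^sub>1 = const3 y * A\<^sub>1 + const3 x * B\<^sub>1" "L\<^sub>2 = const3 y * A\<^sub>2 + const3 x * B\<^sub>2"
    unfolding L\<^sub>1_def L\<^sub>2_def linear_form_def Q_def p\<^sub>2_def q\<^sub>2_def A\<^sub>1_def B\<^sub>1_def A\<^sub>2_def B\<^sub>2_def
    unfolding n
    by (simp_all add: power_add algebra_simps power2_eq_square eval_nat_numeral)
  define \<Delta> where "\<Delta> = A\<^sub>1 * B\<^sub>2 - B\<^sub>1 * A\<^sub>2"
  have "const3 y * \<Delta> = B\<^sub>2 * L\<^sub>1 - B\<^sub>1 * L\<^sub>2"
    unfolding L \<Delta>_def by (simp add: algebra_simps)
  then have "rees_map f\<^sub>1 f\<^sub>2 f\<^sub>3 (const3 y * \<Delta>) = 0"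
    by simp
  moreover have "rees_map f\<^sub>1 f\<^sub>2 f\<^sub>3 (const3 y) \<noteq> 0"
    by (simp add: rees_map_def subst3_simps comm_hom_const) (simp add: varY_def)
  ultimately have "rees_map f\<^sub>1 f\<^sub>2 f\<^sub>3 \<Delta> = 0"
    by simp
  then obtain u v where \<Delta>: "\<Delta> = u * L\<^sub>1 + v * L\<^sub>2"
    using lt unfolding linear_type_gradient_ideal_iff by blast

  define \<tau> :: "'k poly" where "\<tau> = [:0, 1:]"
  \<comment> \<open>The curve \<open>Q = 0\<close> in the plane \<open>w = 1\<close>, parametrized by \<open>x\<close>; the image of \<open>z\<close> is solved
    from \<open>w = 1\<close>.\<close>
  define \<eta> where "\<eta> = [:- (\<gamma> / \<epsilon>):] * \<tau> ^ 2"
  define \<psi> where "\<psi> = subst3 (\<lambda>c. [:c:]) \<tau> \<eta> (1 - [:a\<^sub>3:] * \<tau> - [:a\<^sub>4:] * \<eta>)"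
  have hom_\<psi>: "comm_hom \<psi>"
    unfolding \<psi>_def by (rule comm_hom_subst3[OF comm_hom_const])
  interpret \<psi>: comm_hom \<psi> by (rule hom_\<psi>)
  have \<psi> [simp]: "\<psi> (const3 c) = [:c:]" "\<psi> x = \<tau>" "\<psi> y = \<eta>" "\<psi> z = 1 - [:a\<^sub>3:] * \<tau> - [:a\<^sub>4:] * \<eta>" for c
    by (simp_all only: \<psi>_def subst3_simps[OF comm_hom_const])
  have \<psi>_w [simp]: "\<psi> w = 1"
    by (simp add: w_def)
  define \<Psi> where "\<Psi> = subst3 \<psi> 1 0 0"
  interpret \<Psi>: comm_hom \<Psi>
    unfolding \<Psi>_def by (rule comm_hom_subst3[OF hom_\<psi>])
  have \<Psi> [simp]: "\<Psi> (const3 c) = \<psi> c" "\<Psi> T\<^sub>1 = 0" "\<Psi> T\<^sub>2 = 0" "\<Psi> T\<^sub>3 = 1" for c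
    by (simp_all add: \<Psi>_def subst3_simps[OF hom_\<psi>])

  \<comment> \<open>The form \<open>L\<^sub>2\<close> specializes to \<open>- \<tau>\<^bsup>m+1\<^esup> K\<close>, where \<open>K\<close> does not vanish at the origin.\<close>
  define K where "K = [:\<kappa> * \<epsilon> ^ 2:] + [:\<delta> * (- (\<gamma> / \<epsilon>)) ^ (m + 2):] * \<tau> ^ (m + 4)"
  have \<eta>_power: "\<eta> ^ (m + 2) = [:(- (\<gamma> / \<epsilon>)) ^ (m + 2):] * \<tau> ^ (2 * (m + 2))"
    by (simp only: \<eta>_def power_mult_distrib poly_const_pow power_mult)
  have K: "[:\<kappa>:] * [:\<epsilon>:] ^ 2 * \<tau> ^ m + [:\<delta>:] * \<eta> ^ (m + 2) = \<tau> ^ m * K"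
    unfolding \<eta>_power K_def
    by (simp add: poly_const_pow power_add power_mult algebra_simps eval_nat_numeral)
  have "\<Psi> B\<^sub>2 = - (\<tau> ^ m * K)" "\<Psi> A\<^sub>2 = 0" "\<Psi> A\<^sub>1 = - [:\<epsilon>:]"
    by (simp_all add: A\<^sub>1_def A\<^sub>2_def B\<^sub>2_def flip: K)
  moreover have "\<Psi> L\<^sub>1 = 0"
    by (simp add: L\<^sub>1_eq \<eta>_def)
  moreover have "\<Psi> L\<^sub>2 = \<tau> * \<Psi> B\<^sub>2"
    unfolding L using \<open>\<Psi> A\<^sub>2 = 0\<close> by simp
  moreover have "\<Psi> \<Delta> = \<Psi> u * \<Psi> L\<^sub>1 + \<Psi> v * \<Psi> L\<^sub>2"
    using \<Delta> by simp
  ultimately have "\<tau> ^ m * ([:\<epsilon>:] * K) = \<tau> ^ m * (- (\<Psi> v * \<tau> * K))"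
    by (simp add: \<Delta>_def algebra_simps)
  then have "[:\<epsilon>:] * K = - (\<Psi> v * \<tau> * K)"
    by (subst (asm) mult_cancel_left) (simp add: \<tau>_def)
  then have "poly ([:\<epsilon>:] * K) 0 = poly (- (\<Psi> v * \<tau> * K)) 0"
    by (rule arg_cong)
  then show False
    by (simp add: K_def \<tau>_def zero_power)
qed

end

section \<open>Freeness and linear type in all degrees\<close>

theorem proposition2p2:
  fixes a\<^sub>1 a\<^sub>2 a\<^sub>3 a\<^sub>4 :: "'k::{alg_closed_field, field_char_0}"
    and d :: nat
    and F :: "'k poly3"
  assumes "d \<ge> 5" and "a\<^sub>1 \<noteq> 0" and "a\<^sub>2 \<noteq> 0"
    and "F = varY ^ (d - 1) * varZ + const3 a\<^sub>1 * varX ^ d + const3 a\<^sub>2 * varX ^ 2 * varY ^ (d - 2)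
             + const3 a\<^sub>3 * varX * varY ^ (d - 1) + const3 a\<^sub>4 * varY ^ d"
  shows "(irreducible_algebraic_set (zero_locus {F}) \<and> free_divisor F) \<and>
         (linear_type (gradient_ideal F) \<longleftrightarrow> d = 5)"
proof -
  obtain n where d: "d = n + 5"
    using \<open>d \<ge> 5\<close> by (metis add.commute le_Suc_ex)
  interpret C: rational_curve a\<^sub>1 a\<^sub>2 a\<^sub>3 a\<^sub>4 n
    by unfold_locales fact+
  have "F = C.F"
    unfolding assms(4) C.F_def d by (simp add: add.commute)
  then show ?thesis
    using C.irreducible_zero_locus_F C.free_divisor_F C.linear_type_if_degree_5
      C.not_linear_type_if_degree_gt_5 d by (cases n) auto
qed

end
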